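(* Let $L$ be a completely regular frame. Then the Riesz space $\mathrm{H}_{nf}(L)$ of nearly finite Hausdorff continuous functions on $L$, together with the inclusion $\mathrm{C}(L)\subseteq\mathrm{H}_{nf}(L)$, is the universal completion of the Riesz space $\mathrm{C}(L)$.
   Context: Frames: $a^\ast$ denotes the pseudocomplement $\bigvee\{b\mid a\wedge b=0\}$ in a frame $L$. Write $b\prec a$ if $b^\ast\vee a=1$, and $b\prec\!\!\prec a$ if there are $c_r\in L$ ($r\in\mathbb{Q}\cap[0,1]$) with $b\le c_0$, $c_1\le a$, $c_r\prec c_s$ for $r<s$. $L$ is completely regular if $a=\bigvee\{b\mid b\prec\!\!\prec a\}$ for all $a$. $\mathfrak{B}(L)=\{a\in L\mid a=a^{\ast\ast}\}$ is the Booleanization (a complete Boolean algebra with meets as in $L$ and joins $(\bigvee^L A)^{\ast\ast}$), and $\beta\colon L\to\mathfrak{B}(L)$, $\beta(a)=a^{\ast\ast}$, is a frame homomorphism. Consider generators $(p,-)$ and $(-,p)$, $p\in\mathbb{Q}$, and relations (r1) $(p,-)\wedge(-,q)=0$ if $p\ge q$; (r2) $(p,-)\vee(-,q)=1$ if $p<q$; (r3) $(p,-)=\bigvee_{q>p}(q,-)$; (r4) $(-,p)=\bigvee_{q<p}(-,q)$; (r5) $\bigvee_p(p,-)=1$; (r6) $\bigvee_p(-,p)=1$. $\mathfrak{L}(\mathbb{R})$ is the frame presented by (r1)–(r6); $\mathfrak{L}(\overline{\mathbb{IR}})$ is the frame presented by (r1), (r3), (r4) only. $\mathrm{C}(L)$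 is the set of frame homomorphisms $\mathfrak{L}(\mathbb{R})\to L$, and $\overline{\mathrm{IC}}(L)$ the set of frame homomorphisms $\mathfrak{L}(\overline{\mathbb{IR}})\to L$; $\mathrm{C}(L)$ is identified with the set of those $f\in\overline{\mathrm{IC}}(L)$ turning (r2), (r5), (r6) into identities in $L$. Order on $\overline{\mathrm{IC}}(L)$: $f\le g$ iff $f(p,-)\le g(p,-)$ and $f(-,q)\ge g(-,q)$ for all $p,q\in\mathbb{Q}$ (on $\mathrm{C}(L)$ either condition suffices). $\mathrm{C}(L)$ is an Archimedean Riesz space with $(f\vee g)(p,-)=f(p,-)\vee g(p,-)$, $(f\wedge g)(p,-)=f(p,-)\wedge g(p,-)$, $(f+g)(p,-)=\bigvee_{r\in\mathbb{Q}}f(r,-)\wedge g(p-r,-)$, $(f+g)(-,q)=\bigvee_{s\in\mathbb{Q}}f(-,s)\wedge g(-,q-s)$, $(-f)(p,-)=f(-,-p)$, $(-f)(-,q)=f(-q,-)$, and for $\lambda>0$ $(\lambda f)(p,-)=\bigvee\{f(r,-)\mid r\in\mathbb{Q},\lambda r>p\}$, $(\lambda f)(-,q)=\bigvee\{f(-,s)\mid s\in\mathbb{Q},\lambda s<q\}$. $f\in\overline{\mathrm{IC}}(L)$ is Hausdorff continuous if $f(p,-)^\ast\le f(-,q)$ and $f(-,q)^\ast\le f(p,-)$ for all $p<q$ in $\mathbb{Q}$; it is nearly finite if moreover $(\bigvee_p f(p,-))^{\ast\ast}=1=(\bigvee_q f(-,q))^{\ast\ast}$. $\mathrm{H}_{nf}(L)$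 is the set of nearly finite Hausdorff continuous functions with the order of $\overline{\mathrm{IC}}(L)$. The maps $\Gamma\colon\mathrm{H}_{nf}(L)\to\mathrm{C}(\mathfrak{B}(L))$, $\Gamma(f)=\beta\circ f$, and $\Delta\colon\mathrm{C}(\mathfrak{B}(L))\to\mathrm{H}_{nf}(L)$, $\Delta(g)(p,-)=\bigvee^L_{r>p}g(r,-)$, $\Delta(g)(-,q)=\bigvee^L_{s<q}g(-,s)$, are mutually inverse order isomorphisms (known), and $\mathrm{H}_{nf}(L)$ carries the Riesz space structure transported along them: $\lambda\odot f=\Delta(\lambda\cdot\Gamma(f))$, $f\oplus g=\Delta(\Gamma(f)+\Gamma(g))$. A Riesz space is universally complete if it is Dedekind complete (nonempty subsets bounded above have suprema) and laterally complete (every nonempty set of pairwise disjoint positive elements has a supremum). A universal completion of $R$ is a universally complete Riesz space $\mathcal{U}(R)$ with a Riesz space embedding $\mu\colon R\to\mathcal{U}(R)$ such that $f=\bigvee\{\mu(g)\mid g\in R,\ 0\le\mu(g)\le f\}$ for all $f\in\mathcal{U}(R)^+$. *)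

theory Defs
  imports Complex_Main "HOL-Library.FSet"
begin

unbundle lattice_syntax

section \<open>Frames and pseudocomplements\<close>

class frame = complete_lattice +
  assumes inf_Sup_distrib: "a \<sqinter> \<Squnion>B = (\<Squnion>b\<in>B. a \<sqinter> b)"

definition frame_hom :: "('a::frame \<Rightarrow> 'b::frame) \<Rightarrow> bool" where
  "frame_hom h \<longleftrightarrow>
     h top = top \<and> (\<forall>a b. h (a \<sqinter> b) = h a \<sqinter> h b) \<and> (\<forall>A. h (\<Squnion>A) = (\<Squnion>a\<in>A. h a))"

definition pcompl :: "'a::frame \<Rightarrow> 'a" where
  "pcompl a = \<Squnion>{b. a \<sqinter> b = bot}"

definition rather_below :: "'a::frame \<Rightarrow> 'a \<Rightarrow> bool" where
  "rather_below b a \<longleftrightarrow> pcompl b \<squnion> a = top"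

definition completely_below :: "'a::frame \<Rightarrow> 'a \<Rightarrow> bool" where
  "completely_below b a \<longleftrightarrow>
     (\<exists>c :: rat \<Rightarrow> 'a. b \<le> c 0 \<and> c 1 \<le> a \<and>
        (\<forall>r s. 0 \<le> r \<and> r < s \<and> s \<le> 1 \<longrightarrow> rather_below (c r) (c s)))"

definition completely_regular :: "'a::frame itself \<Rightarrow> bool" where
  "completely_regular _ \<longleftrightarrow> (\<forall>a::'a. a = \<Squnion>{b. completely_below b a})"

lemma inf_pcompl: "a \<sqinter> pcompl a = (bot :: 'a::frame)"
  by (auto simp: pcompl_def inf_Sup_distrib intro!: SUP_eqI)

lemma le_pcompl_iff: "b \<le> pcompl a \<longleftrightarrow> a \<sqinter> b = (bot :: 'a::frame)"
proof
  assume "b \<le> pcompl a"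
  then have "a \<sqinter> b \<le> a \<sqinter> pcompl a" by (intro inf_mono) auto
  then show "a \<sqinter> b = bot" by (simp add: inf_pcompl bot_unique)
qed (auto simp: pcompl_def intro: Sup_upper)

lemma pcompl_antimono: "(a :: 'a::frame) \<le> b \<Longrightarrow> pcompl b \<le> pcompl a"
  unfolding le_pcompl_iff
  by (metis bot_unique inf_mono inf_pcompl order_refl)

lemma le_pcompl_pcompl: "(a :: 'a::frame) \<le> pcompl (pcompl a)"
  by (simp add: le_pcompl_iff inf_pcompl inf_commute)

lemma pcompl_mono2: "(a :: 'a::frame) \<le> b \<Longrightarrow> pcompl (pcompl a) \<le> pcompl (pcompl b)"
  by (intro pcompl_antimono)

lemma pcompl_triple [simp]: "pcompl (pcompl (pcompl a)) = pcompl (a :: 'a::frame)"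
  by (intro order.antisym pcompl_antimono le_pcompl_pcompl)

lemma pcompl_pcompl_inf:
  "pcompl (pcompl (a \<sqinter> b)) = pcompl (pcompl a) \<sqinter> pcompl (pcompl (b :: 'a::frame))"
proof (rule order.antisym)
  have *: "b \<sqinter> (c \<sqinter> pcompl (pcompl a)) = bot" if "b \<sqinter> (c \<sqinter> a) = bot" for a b c :: 'a
  proof -
    have "b \<sqinter> c \<le> pcompl a"
      using that by (simp add: le_pcompl_iff ac_simps)
    then have "pcompl (pcompl a) \<sqinter> (b \<sqinter> c) = bot"
      by (metis inf.absorb2 inf_bot_right inf_commute inf_left_commute inf_pcompl)
    then show ?thesis by (simp add: ac_simps)
  qed
  have "pcompl (a \<sqinter> b) \<sqinter> (b \<sqinter> a) = bot"
    by (metis inf_commute inf_pcompl)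
  then have "pcompl (a \<sqinter> b) \<sqinter> (b \<sqinter> pcompl (pcompl a)) = bot" by (rule *)
  then have "pcompl (a \<sqinter> b) \<sqinter> (pcompl (pcompl a) \<sqinter> pcompl (pcompl b)) = bot"
    using *[of "pcompl (a \<sqinter> b)" "pcompl (pcompl a)" b] by (simp add: ac_simps)
  then show "pcompl (pcompl a) \<sqinter> pcompl (pcompl b) \<le> pcompl (pcompl (a \<sqinter> b))"
    by (simp add: le_pcompl_iff)
qed (auto intro!: pcompl_mono2)


section \<open>The Booleanization\<close>

typedef (overloaded) 'a booln = "{a :: 'a::frame. pcompl (pcompl a) = a}"
  by (rule exI[of _ "pcompl bot"]) simp

setup_lifting type_definition_booln

instantiation booln :: (frame) frame
begin

lift_definition less_eq_booln :: "'a booln \<Rightarrow> 'a booln \<Rightarrow> bool" is "(\<le>)" .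
lift_definition less_booln :: "'a booln \<Rightarrow> 'a booln \<Rightarrow> bool" is "(<)" .
lift_definition inf_booln :: "'a booln \<Rightarrow> 'a booln \<Rightarrow> 'a booln" is "(\<sqinter>)"
  by (simp add: pcompl_pcompl_inf)
lift_definition sup_booln :: "'a booln \<Rightarrow> 'a booln \<Rightarrow> 'a booln"
  is "\<lambda>a b. pcompl (pcompl (a \<squnion> b))" by simp
lift_definition top_booln :: "'a booln" is top
  by (metis le_pcompl_pcompl top_unique)
lift_definition bot_booln :: "'a booln" is bot
  by (metis inf_pcompl inf_top_left le_pcompl_iff bot_unique le_pcompl_pcompl order_refl pcompl_triple)
lift_definition Inf_booln :: "'a booln set \<Rightarrow> 'a booln" is Inf
proof (rule order.antisym)
  fix A :: "'a set" assume A: "\<And>a. a \<in> A \<Longrightarrow> pcompl (pcompl a) = a"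
  show "pcompl (pcompl (\<Sqinter>A)) \<le> \<Sqinter>A"
    by (rule Inf_greatest) (metis A Inf_lower pcompl_mono2)
qed (rule le_pcompl_pcompl)
lift_definition Sup_booln :: "'a booln set \<Rightarrow> 'a booln" is "\<lambda>A. pcompl (pcompl (\<Squnion>A))"
  by simp

instance
proof
  fix x y z :: "'a booln" and A :: "'a booln set"
  show "x < y \<longleftrightarrow> x \<le> y \<and> \<not> y \<le> x" by transfer auto
  show "x \<le> x" by transfer simp
  show "x \<le> y \<Longrightarrow> y \<le> z \<Longrightarrow> x \<le> z" by transfer simp
  show "x \<le> y \<Longrightarrow> y \<le> x \<Longrightarrow> x = y" by transfer simp
  show "x \<sqinter> y \<le> x" "x \<sqinter> y \<le> y" by (transfer, simp)+
  show "x \<le> y \<Longrightarrow> x \<le> z \<Longrightarrow> x \<le> y \<sqinter> z" by transfer simp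
  show "x \<le> x \<squnion> y" "y \<le> x \<squnion> y"
    by (transfer, meson le_pcompl_pcompl order_trans sup_ge1 sup_ge2)+
  show "y \<le> x \<Longrightarrow> z \<le> x \<Longrightarrow> y \<squnion> z \<le> x"
    by transfer (metis le_sup_iff pcompl_mono2)
  show "x \<in> A \<Longrightarrow> \<Sqinter>A \<le> x" by transfer (simp add: Inf_lower)
  show "(\<And>x. x \<in> A \<Longrightarrow> z \<le> x) \<Longrightarrow> z \<le> \<Sqinter>A" by transfer (auto intro: Inf_greatest)
  show "x \<in> A \<Longrightarrow> x \<le> \<Squnion>A" by transfer (meson Sup_upper le_pcompl_pcompl order_trans)
  show "\<Squnion>A \<le> z" if "\<And>x. x \<in> A \<Longrightarrow> x \<le> z"
  proof -
    have "\<Squnion>(Rep_booln ` A) \<le> Rep_booln z"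
      using that by (auto simp: less_eq_booln.rep_eq intro: Sup_least)
    then have "pcompl (pcompl (\<Squnion>(Rep_booln ` A))) \<le> Rep_booln z"
      using Rep_booln[of z] pcompl_mono2 by fastforce
    then show ?thesis by (simp add: less_eq_booln.rep_eq Sup_booln.rep_eq)
  qed
  show "\<Sqinter>{} = (top :: 'a booln)" by transfer simp
  show "\<Squnion>{} = (bot :: 'a booln)"
    by transfer (metis Sup_empty inf_pcompl inf_top_left le_pcompl_iff bot_unique le_pcompl_pcompl
        order_refl pcompl_triple)
  show "x \<sqinter> \<Squnion>A = (\<Squnion>b\<in>A. x \<sqinter> b)"
    by transfer (simp add: inf_Sup_distrib[symmetric] pcompl_pcompl_inf)
qed

end

lift_definition beta :: "'a::frame \<Rightarrow> 'a booln" is "\<lambda>a. pcompl (pcompl a)" by simp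


section \<open>Frames presented by generators and relations\<close>

text \<open>
  The free frame on a set of generators consists of the upward closed families of finite sets of
  generators, a family \<open>U\<close> standing for the join over \<open>F \<in> U\<close> of the finite meets of
  the \<open>F\<close>. A relation is a pair \<open>(A, B)\<close> of families, read as the equation
  \<open>\<Or>\<^bsub>F\<in>A\<^esub> \<And>F = \<Or>\<^bsub>F\<in>B\<^esub> \<And>F\<close>. The quotient by the congruence generated by the
  relations is realised on the saturated elements.
\<close>

definition saturated :: "('g fset set \<times> 'g fset set) set \<Rightarrow> 'g fset set \<Rightarrow> bool" where
  "saturated R U \<longleftrightarrow>
     (\<forall>F G. F \<in> U \<and> F |\<subseteq>| G \<longrightarrow> G \<in> U) \<and>
     (\<forall>(A, B)\<in>R. \<forall>C. (\<forall>F\<in>A. F |\<union>| C \<in> U) \<longleftrightarrow> (\<forall>F\<in>B. F |\<union>| C \<in> U))"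

definition fimp :: "'g fset set \<Rightarrow> 'g fset set \<Rightarrow> 'g fset set" where
  "fimp U W = {F. \<forall>G\<in>U. F |\<union>| G \<in> W}"

lemma saturated_up: "saturated R U \<Longrightarrow> F \<in> U \<Longrightarrow> F |\<subseteq>| G \<Longrightarrow> G \<in> U"
  unfolding saturated_def by blast

lemma saturated_relation:
  "saturated R U \<Longrightarrow> (A, B) \<in> R \<Longrightarrow> (\<forall>F\<in>A. F |\<union>| C \<in> U) \<longleftrightarrow> (\<forall>F\<in>B. F |\<union>| C \<in> U)"
  unfolding saturated_def by fast

lemma saturated_fimp:
  assumes W: "saturated R W"
  shows "saturated R (fimp U W)"
  unfolding saturated_def
proof (intro conjI allI impI ballI; (clarify)?)
  fix F G assume F: "F \<in> fimp U W" "F |\<subseteq>| G"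
  show "G \<in> fimp U W"
    unfolding fimp_def
  proof clarify
    fix H assume "H \<in> U"
    then have "F |\<union>| H \<in> W" using F by (auto simp: fimp_def)
    moreover have "F |\<union>| H |\<subseteq>| G |\<union>| H" using F by auto
    ultimately show "G |\<union>| H \<in> W" by (rule saturated_up[OF W])
  qed
next
  fix A B C assume "(A, B) \<in> R"
  then have *: "(\<forall>F\<in>A. F |\<union>| D \<in> W) \<longleftrightarrow> (\<forall>F\<in>B. F |\<union>| D \<in> W)" for D
    using W by (intro saturated_relation)
  have "(\<forall>F\<in>X. F |\<union>| C \<in> fimp U W) \<longleftrightarrow> (\<forall>G\<in>U. \<forall>F\<in>X. F |\<union>| (C |\<union>| G) \<in> W)" for X
    by (auto simp: fimp_def sup.assoc)
  then show "(\<forall>F\<in>A. F |\<union>| C \<in> fimp U W) \<longleftrightarrow> (\<forall>F\<in>B. F |\<union>| C \<in> fimp U W)"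
    using * by simp
qed

lemma saturated_Inter:
  assumes "\<And>U. U \<in> \<U> \<Longrightarrow> saturated R U"
  shows "saturated R (\<Inter>\<U>)"
  unfolding saturated_def
proof (intro conjI allI impI ballI; (clarify)?)
  fix F G U assume "F \<in> \<Inter>\<U>" "F |\<subseteq>| G" "U \<in> \<U>"
  then show "G \<in> U" using saturated_up[OF assms] by blast
next
  fix A B C assume AB: "(A, B) \<in> R"
  have "(\<forall>F\<in>A. F |\<union>| C \<in> U) \<longleftrightarrow> (\<forall>F\<in>B. F |\<union>| C \<in> U)" if "U \<in> \<U>" for U
    using assms[OF that] AB by (rule saturated_relation)
  then show "(\<forall>F\<in>A. F |\<union>| C \<in> \<Inter>\<U>) \<longleftrightarrow> (\<forall>F\<in>B. F |\<union>| C \<in> \<Inter>\<U>)"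
    unfolding Inter_iff by blast
qed

lemma saturated_Int: "saturated R U \<Longrightarrow> saturated R V \<Longrightarrow> saturated R (U \<inter> V)"
  using saturated_Inter[of "{U, V}" R] by auto

text \<open>\<open>GAbove p\<close> is the generator \<open>(p,-)\<close> and \<open>GBelow p\<close> is the generator \<open>(-,p)\<close>.\<close>

datatype gen = GAbove rat | GBelow rat

definition IR_relations :: "(gen fset set \<times> gen fset set) set" where
  "IR_relations =
     {({{|GAbove p, GBelow q|}}, {}) | p q. p \<ge> q} \<union>
     {({{|GAbove p|}}, {{|GAbove q|} | q. q > p}) | p. True} \<union>
     {({{|GBelow p|}}, {{|GBelow q|} | q. q < p}) | p. True}"

typedef IR = "{U. saturated IR_relations U}"
  by (rule exI[of _ UNIV]) (simp add: saturated_def)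

setup_lifting type_definition_IR

instantiation IR :: complete_lattice
begin

lift_definition less_eq_IR :: "IR \<Rightarrow> IR \<Rightarrow> bool" is "(\<subseteq>)" .
lift_definition less_IR :: "IR \<Rightarrow> IR \<Rightarrow> bool" is "(\<subset>)" .
lift_definition inf_IR :: "IR \<Rightarrow> IR \<Rightarrow> IR" is "(\<inter>)" by (rule saturated_Int)
lift_definition sup_IR :: "IR \<Rightarrow> IR \<Rightarrow> IR"
  is "\<lambda>U V. \<Inter>{W. saturated IR_relations W \<and> U \<subseteq> W \<and> V \<subseteq> W}"
  by (rule saturated_Inter) auto
lift_definition top_IR :: IR is UNIV by (simp add: saturated_def)
lift_definition bot_IR :: IR is "\<Inter>{W. saturated IR_relations W}"
  by (rule saturated_Inter) auto
lift_definition Inf_IR :: "IR set \<Rightarrow> IR" is Inter by (rule saturated_Inter) auto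
lift_definition Sup_IR :: "IR set \<Rightarrow> IR"
  is "\<lambda>\<U>. \<Inter>{W. saturated IR_relations W \<and> \<Union>\<U> \<subseteq> W}"
  by (rule saturated_Inter) auto

instance
proof
  fix x y z :: IR and A :: "IR set"
  show "x < y \<longleftrightarrow> x \<le> y \<and> \<not> y \<le> x" by transfer auto
  show "x \<le> x" by transfer simp
  show "x \<le> y \<Longrightarrow> y \<le> z \<Longrightarrow> x \<le> z" by transfer simp
  show "x \<le> y \<Longrightarrow> y \<le> x \<Longrightarrow> x = y" by transfer simp
  show "x \<sqinter> y \<le> x" "x \<sqinter> y \<le> y" by (transfer, simp)+
  show "x \<le> y \<Longrightarrow> x \<le> z \<Longrightarrow> x \<le> y \<sqinter> z" by transfer simp
  show "x \<le> x \<squnion> y" "y \<le> x \<squnion> y" by (transfer, blast)+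
  show "y \<le> x \<Longrightarrow> z \<le> x \<Longrightarrow> y \<squnion> z \<le> x" by transfer blast
  show "x \<in> A \<Longrightarrow> \<Sqinter>A \<le> x" by transfer blast
  show "(\<And>x. x \<in> A \<Longrightarrow> z \<le> x) \<Longrightarrow> z \<le> \<Sqinter>A" by transfer blast
  show "x \<in> A \<Longrightarrow> x \<le> \<Squnion>A" for x :: IR and A
    by (auto simp: less_eq_IR.rep_eq Sup_IR.rep_eq)
  show "\<Squnion>A \<le> z" if "\<And>x. x \<in> A \<Longrightarrow> x \<le> z" for A and z :: IR
  proof -
    have "\<Union>(Rep_IR ` A) \<subseteq> Rep_IR z"
      using that by (auto simp: less_eq_IR.rep_eq)
    then show ?thesis
      using Rep_IR[of z] unfolding less_eq_IR.rep_eq Sup_IR.rep_eq by blast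
  qed
  show "\<Sqinter>{} = (top :: IR)" by transfer simp
  show "\<Squnion>{} = (bot :: IR)" by transfer simp
qed

end

instance IR :: frame
proof
  fix x :: IR and A :: "IR set"
  show "x \<sqinter> \<Squnion>A = (\<Squnion>b\<in>A. x \<sqinter> b)"
  proof (rule order.antisym)
    show "x \<sqinter> \<Squnion>A \<le> (\<Squnion>b\<in>A. x \<sqinter> b)"
    proof -
      define W where "W = Rep_IR (\<Squnion>b\<in>A. x \<sqinter> b)"
      have W: "saturated IR_relations W" using Rep_IR by (simp add: W_def)
      have "Rep_IR b \<subseteq> fimp (Rep_IR x) W" if "b \<in> A" for b
      proof
        fix F assume F: "F \<in> Rep_IR b"
        have "x \<sqinter> b \<le> (\<Squnion>b\<in>A. x \<sqinter> b)" using that by (intro Sup_upper) auto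
        then have "Rep_IR x \<inter> Rep_IR b \<subseteq> W" by (simp add: W_def less_eq_IR.rep_eq inf_IR.rep_eq)
        moreover have "F |\<union>| G \<in> Rep_IR x \<inter> Rep_IR b" if "G \<in> Rep_IR x" for G
          using F that Rep_IR[of x] Rep_IR[of b] unfolding saturated_def mem_Collect_eq
          by (metis IntI sup_ge1 sup_ge2)
        ultimately show "F \<in> fimp (Rep_IR x) W" by (auto simp: fimp_def)
      qed
      then have "Rep_IR (\<Squnion>A) \<subseteq> fimp (Rep_IR x) W"
        using saturated_fimp[OF W] unfolding Sup_IR.rep_eq by blast
      then have "Rep_IR x \<inter> Rep_IR (\<Squnion>A) \<subseteq> W" by (fastforce simp: fimp_def)
      then show ?thesis by (simp add: W_def less_eq_IR.rep_eq inf_IR.rep_eq)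
    qed
    show "(\<Squnion>b\<in>A. x \<sqinter> b) \<le> x \<sqinter> \<Squnion>A"
      by (intro SUP_least inf_mono order_refl Sup_upper)
  qed
qed

lift_definition ideal :: "gen fset \<Rightarrow> IR"
  is "\<lambda>F. \<Inter>{U. saturated IR_relations U \<and> F \<in> U}"
  by (rule saturated_Inter) auto

lemma ideal_le_iff: "ideal F \<le> U \<longleftrightarrow> F \<in> Rep_IR U"
  using Rep_IR[of U] by (auto simp: less_eq_IR.rep_eq ideal.rep_eq)

lemma in_ideal: "F \<in> Rep_IR (ideal F)"
  by (auto simp: ideal.rep_eq)

lemma Rep_IR_up: "F \<in> Rep_IR U \<Longrightarrow> F |\<subseteq>| G \<Longrightarrow> G \<in> Rep_IR U"
  using Rep_IR[of U] by (auto simp: saturated_def)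

lemma Rep_IR_relation:
  "(A, B) \<in> IR_relations \<Longrightarrow> (\<forall>F\<in>A. F |\<union>| C \<in> Rep_IR U) \<longleftrightarrow> (\<forall>F\<in>B. F |\<union>| C \<in> Rep_IR U)"
  using Rep_IR[of U] by (intro saturated_relation) auto

lemma ideal_inf: "ideal F \<sqinter> ideal G = ideal (F |\<union>| G)"
proof (rule order.antisym)
  let ?W = "Rep_IR (ideal (F |\<union>| G))"
  have W: "saturated IR_relations ?W" using Rep_IR by simp
  have "F \<in> fimp {G} ?W" by (simp add: fimp_def in_ideal)
  then have 1: "Rep_IR (ideal F) \<subseteq> fimp {G} ?W"
    using saturated_fimp[OF W] by (auto simp: ideal.rep_eq)
  then have "G \<in> fimp (Rep_IR (ideal F)) ?W" by (auto simp: fimp_def sup_commute)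
  then have "Rep_IR (ideal G) \<subseteq> fimp (Rep_IR (ideal F)) ?W"
    using saturated_fimp[OF W] by (auto simp: ideal.rep_eq)
  then show "ideal F \<sqinter> ideal G \<le> ideal (F |\<union>| G)"
    by (fastforce simp: less_eq_IR.rep_eq inf_IR.rep_eq fimp_def)
  show "ideal (F |\<union>| G) \<le> ideal F \<sqinter> ideal G"
    unfolding ideal_le_iff inf_IR.rep_eq
    by (auto intro: Rep_IR_up[OF in_ideal[of F]] Rep_IR_up[OF in_ideal[of G]])
qed

lemma ideal_empty: "ideal {||} = top"
proof -
  have "F \<in> Rep_IR (ideal {||})" for F by (rule Rep_IR_up[OF in_ideal]) simp
  then show ?thesis by (auto simp: Rep_IR_inject[symmetric] top_IR.rep_eq)
qed

lemma IR_eq_Sup_ideal: "U = (\<Squnion>F\<in>Rep_IR U. ideal F)"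
proof (rule order.antisym)
  have "F \<in> Rep_IR (\<Squnion>F\<in>Rep_IR U. ideal F)" if "F \<in> Rep_IR U" for F
    unfolding ideal_le_iff[symmetric] using that by (rule SUP_upper)
  then show "U \<le> (\<Squnion>F\<in>Rep_IR U. ideal F)" by (auto simp: less_eq_IR.rep_eq)
qed (auto simp: ideal_le_iff intro: SUP_least)

definition above_gen :: "rat \<Rightarrow> IR" where "above_gen p = ideal {|GAbove p|}"
definition below_gen :: "rat \<Rightarrow> IR" where "below_gen q = ideal {|GBelow q|}"

lemma IR_r1: "p \<ge> q \<Longrightarrow> above_gen p \<sqinter> below_gen q = bot"
proof -
  assume "p \<ge> q"
  then have "({{|GAbove p, GBelow q|}}, {}) \<in> IR_relations" by (auto simp: IR_relations_def)
  from Rep_IR_relation[OF this, of "{||}" bot]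
  have "ideal {|GAbove p, GBelow q|} \<le> bot" by (simp add: ideal_le_iff)
  then show ?thesis by (simp add: above_gen_def below_gen_def ideal_inf finsert_commute bot_unique)
qed

lemma IR_r3: "above_gen p = (\<Squnion>q\<in>{p<..}. above_gen q)"
proof -
  have "above_gen p \<le> U \<longleftrightarrow> (\<forall>q\<in>{p<..}. above_gen q \<le> U)" for U
  proof -
    have "({{|GAbove p|}}, {{|GAbove q|} | q. q > p}) \<in> IR_relations"
      by (auto simp: IR_relations_def)
    from Rep_IR_relation[OF this, of "{||}" U] show ?thesis
      by (auto simp: above_gen_def ideal_le_iff)
  qed
  note le_iff = this
  show ?thesis
  proof (rule order.antisym)
    show "above_gen p \<le> (\<Squnion>q\<in>{p<..}. above_gen q)" unfolding le_iff by (auto intro: SUP_upper)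
    show "(\<Squnion>q\<in>{p<..}. above_gen q) \<le> above_gen p" using le_iff[of "above_gen p"] by (auto intro: SUP_least)
  qed
qed

lemma IR_r4: "below_gen q = (\<Squnion>p\<in>{..<q}. below_gen p)"
proof -
  have "below_gen q \<le> U \<longleftrightarrow> (\<forall>p\<in>{..<q}. below_gen p \<le> U)" for U
  proof -
    have "({{|GBelow q|}}, {{|GBelow p|} | p. p < q}) \<in> IR_relations"
      by (auto simp: IR_relations_def)
    from Rep_IR_relation[OF this, of "{||}" U] show ?thesis
      by (auto simp: below_gen_def ideal_le_iff)
  qed
  note le_iff = this
  show ?thesis
  proof (rule order.antisym)
    show "below_gen q \<le> (\<Squnion>p\<in>{..<q}. below_gen p)" unfolding le_iff by (auto intro: SUP_upper)
    show "(\<Squnion>p\<in>{..<q}. below_gen p) \<le> below_gen q" using le_iff[of "below_gen q"] by (auto intro: SUP_least)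
  qed
qed

theorem IR_universal:
  fixes u d :: "rat \<Rightarrow> 'a::frame"
  assumes r1: "\<And>p q. p \<ge> q \<Longrightarrow> u p \<sqinter> d q = bot"
    and r3: "\<And>p. u p = (\<Squnion>q\<in>{p<..}. u q)"
    and r4: "\<And>q. d q = (\<Squnion>p\<in>{..<q}. d p)"
  shows "\<exists>!h. frame_hom h \<and> (\<forall>p. h (above_gen p) = u p) \<and> (\<forall>q. h (below_gen q) = d q)"
proof (rule ex_ex1I)
  define v where "v g = (case g of GAbove p \<Rightarrow> u p | GBelow q \<Rightarrow> d q)" for g
  define m where "m F = (\<Sqinter>g\<in>fset F. v g)" for F
  define h where "h U = (\<Squnion>F\<in>Rep_IR U. m F)" for U
  have m_Un: "m (F |\<union>| G) = m F \<sqinter> m G" for F G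
    by (simp add: m_def INF_union)
  have Sup_inf: "\<Squnion>A \<sqinter> a = (\<Squnion>b\<in>A. b \<sqinter> a)" for A and a :: 'a
    by (simp add: inf_commute[of _ a] inf_Sup_distrib)
  have sat: "saturated IR_relations {F. m F \<le> a}" for a
    unfolding saturated_def
  proof (intro conjI allI impI ballI; clarify)
    fix F G assume "m F \<le> a" "F |\<subseteq>| G"
    then show "m G \<le> a"
      by (metis m_Un inf.coboundedI1 sup.absorb_iff2)
  next
    fix A B C assume AB: "(A, B) \<in> IR_relations"
    have eq: "(\<Squnion>F\<in>A. m F) = (\<Squnion>F\<in>B. m F)"
    proof -
      have "(\<Squnion>F\<in>{{|GAbove q|} | q. q > p}. m F) = (\<Squnion>q\<in>{p<..}. u q)" for p
      proof -
        have "{{|GAbove q|} | q. q > p} = (\<lambda>q. {|GAbove q|}) ` {p<..}" by auto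
        then show ?thesis by (simp add: image_image m_def v_def)
      qed
      moreover have "(\<Squnion>F\<in>{{|GBelow q|} | q. q < p}. m F) = (\<Squnion>q\<in>{..<p}. d q)" for p
      proof -
        have "{{|GBelow q|} | q. q < p} = (\<lambda>q. {|GBelow q|}) ` {..<p}" by auto
        then show ?thesis by (simp add: image_image m_def v_def)
      qed
      ultimately show ?thesis
        using AB r1 by (auto simp: IR_relations_def m_def v_def r3[symmetric] r4[symmetric])
    qed
    have "(\<forall>F\<in>X. F |\<union>| C \<in> {F. m F \<le> a}) \<longleftrightarrow> (\<Squnion>F\<in>X. m F) \<sqinter> m C \<le> a" for X
      by (simp add: Sup_inf m_Un image_image SUP_le_iff)
    then show "(\<forall>F\<in>A. F |\<union>| C \<in> {F. m F \<le> a}) \<longleftrightarrow> (\<forall>F\<in>B. F |\<union>| C \<in> {F. m F \<le> a})"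
      using eq by simp
  qed
  have h_le: "h U \<le> a \<longleftrightarrow> U \<le> Abs_IR {F. m F \<le> a}" for U a
    using sat by (auto simp: h_def SUP_le_iff less_eq_IR.rep_eq Abs_IR_inverse)
  have h_ideal: "h (ideal F) = m F" for F
  proof -
    have "h (ideal F) \<le> a \<longleftrightarrow> m F \<le> a" for a
      using sat by (simp add: h_le ideal_le_iff Abs_IR_inverse)
    then show ?thesis by (blast intro: order.antisym)
  qed
  have "frame_hom h"
    unfolding frame_hom_def
  proof (intro conjI allI)
    show "h top = top" using h_ideal[of "{||}"] by (simp add: ideal_empty m_def)
    have mono: "h U \<le> h V" if "U \<le> V" for U V
      using that unfolding h_def less_eq_IR.rep_eq by (rule SUP_subset_mono) auto
    show "h (U \<sqinter> V) = h U \<sqinter> h V" for U V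
    proof (rule order.antisym)
      show "h (U \<sqinter> V) \<le> h U \<sqinter> h V" by (simp add: mono)
      have "m F \<sqinter> m G \<le> h (U \<sqinter> V)" if "F \<in> Rep_IR U" "G \<in> Rep_IR V" for F G
      proof -
        have "F |\<union>| G \<in> Rep_IR (U \<sqinter> V)"
          using that by (auto simp: inf_IR.rep_eq intro: Rep_IR_up)
        then show ?thesis unfolding h_def m_Un[symmetric] by (rule SUP_upper)
      qed
      then show "h U \<sqinter> h V \<le> h (U \<sqinter> V)"
        unfolding h_def[of U] h_def[of V]
        by (simp add: Sup_inf inf_Sup_distrib image_image SUP_le_iff)
    qed
    show "h (\<Squnion>A) = (\<Squnion>U\<in>A. h U)" for A
    proof -
      have "h (\<Squnion>A) \<le> a \<longleftrightarrow> (\<Squnion>U\<in>A. h U) \<le> a" for a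
        by (simp add: h_le Sup_le_iff SUP_le_iff)
      then show ?thesis by (blast intro: order.antisym)
    qed
  qed
  then show "\<exists>h. frame_hom h \<and> (\<forall>p. h (above_gen p) = u p) \<and> (\<forall>q. h (below_gen q) = d q)"
    by (intro exI[of _ h]) (simp add: above_gen_def below_gen_def h_ideal m_def v_def)
next
  fix h k :: "IR \<Rightarrow> 'a"
  assume h: "frame_hom h \<and> (\<forall>p. h (above_gen p) = u p) \<and> (\<forall>q. h (below_gen q) = d q)"
    and k: "frame_hom k \<and> (\<forall>p. k (above_gen p) = u p) \<and> (\<forall>q. k (below_gen q) = d q)"
  have g: "h (ideal {|g|}) = k (ideal {|g|})" for g
    using h k by (cases g) (auto simp: above_gen_def below_gen_def)
  have i: "h (ideal F) = k (ideal F)" for F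
  proof (induction F)
    case empty
    then show ?case using h k by (simp add: ideal_empty frame_hom_def)
  next
    case (insert x F)
    have "ideal (finsert x F) = ideal {|x|} \<sqinter> ideal F" by (simp add: ideal_inf)
    then show ?case using insert g h k by (simp add: frame_hom_def)
  qed
  show "h = k"
  proof
    fix U
    have "h (\<Squnion>F\<in>Rep_IR U. ideal F) = k (\<Squnion>F\<in>Rep_IR U. ideal F)"
      using h k i by (simp add: frame_hom_def image_image)
    then show "h U = k U" using IR_eq_Sup_ideal[of U] by simp
  qed
qed

text \<open>The frame homomorphism with prescribed values on the generators.\<close>

definition IR_ext :: "(rat \<Rightarrow> 'a::frame) \<Rightarrow> (rat \<Rightarrow> 'a) \<Rightarrow> IR \<Rightarrow> 'a" where
  "IR_ext u d = (THE h. frame_hom h \<and> (\<forall>p. h (above_gen p) = u p) \<and> (\<forall>q. h (below_gen q) = d q))"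


section \<open>Riesz spaces\<close>

record 'v ordered_space =
  carrier :: "'v set"
  leq :: "'v \<Rightarrow> 'v \<Rightarrow> bool"
  zero :: 'v
  add :: "'v \<Rightarrow> 'v \<Rightarrow> 'v"
  scale :: "real \<Rightarrow> 'v \<Rightarrow> 'v"

definition is_sup :: "('v, 'm) ordered_space_scheme \<Rightarrow> 'v set \<Rightarrow> 'v \<Rightarrow> bool" where
  "is_sup V A s \<longleftrightarrow> s \<in> carrier V \<and> (\<forall>a\<in>A. leq V a s) \<and>
     (\<forall>t\<in>carrier V. (\<forall>a\<in>A. leq V a t) \<longrightarrow> leq V s t)"

definition is_inf :: "('v, 'm) ordered_space_scheme \<Rightarrow> 'v set \<Rightarrow> 'v \<Rightarrow> bool" where
  "is_inf V A s \<longleftrightarrow> s \<in> carrier V \<and> (\<forall>a\<in>A. leq V s a) \<and>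
     (\<forall>t\<in>carrier V. (\<forall>a\<in>A. leq V t a) \<longrightarrow> leq V t s)"

locale riesz_space =
  fixes V :: "('v, 'm) ordered_space_scheme"
  assumes zero_closed: "zero V \<in> carrier V"
    and add_closed: "\<lbrakk>x \<in> carrier V; y \<in> carrier V\<rbrakk> \<Longrightarrow> add V x y \<in> carrier V"
    and scale_closed: "x \<in> carrier V \<Longrightarrow> scale V c x \<in> carrier V"
    and add_assoc: "\<lbrakk>x \<in> carrier V; y \<in> carrier V; z \<in> carrier V\<rbrakk>
      \<Longrightarrow> add V (add V x y) z = add V x (add V y z)"
    and add_commute: "\<lbrakk>x \<in> carrier V; y \<in> carrier V\<rbrakk> \<Longrightarrow> add V x y = add V y x"
    and add_zero: "x \<in> carrier V \<Longrightarrow> add V x (zero V) = x"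
    and add_inverse: "x \<in> carrier V \<Longrightarrow> \<exists>y\<in>carrier V. add V x y = zero V"
    and scale_add_right: "\<lbrakk>x \<in> carrier V; y \<in> carrier V\<rbrakk>
      \<Longrightarrow> scale V c (add V x y) = add V (scale V c x) (scale V c y)"
    and scale_add_left: "x \<in> carrier V \<Longrightarrow> scale V (b + c) x = add V (scale V b x) (scale V c x)"
    and scale_scale: "x \<in> carrier V \<Longrightarrow> scale V b (scale V c x) = scale V (b * c) x"
    and scale_one: "x \<in> carrier V \<Longrightarrow> scale V 1 x = x"
    and leq_refl: "x \<in> carrier V \<Longrightarrow> leq V x x"
    and leq_antisym: "\<lbrakk>x \<in> carrier V; y \<in> carrier V; leq V x y; leq V y x\<rbrakk> \<Longrightarrow> x = y"
    and leq_trans: "\<lbrakk>x \<in> carrier V; y \<in> carrier V; z \<in> carrier V; leq V x y; leq V y z\<rbrakk>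
      \<Longrightarrow> leq V x z"
    and sup_exists: "\<lbrakk>x \<in> carrier V; y \<in> carrier V\<rbrakk> \<Longrightarrow> \<exists>s. is_sup V {x, y} s"
    and inf_exists: "\<lbrakk>x \<in> carrier V; y \<in> carrier V\<rbrakk> \<Longrightarrow> \<exists>s. is_inf V {x, y} s"
    and leq_add: "\<lbrakk>x \<in> carrier V; y \<in> carrier V; z \<in> carrier V; leq V x y\<rbrakk>
      \<Longrightarrow> leq V (add V x z) (add V y z)"
    and leq_scale: "\<lbrakk>x \<in> carrier V; y \<in> carrier V; leq V x y; 0 \<le> c\<rbrakk>
      \<Longrightarrow> leq V (scale V c x) (scale V c y)"

definition dedekind_complete :: "('v, 'm) ordered_space_scheme \<Rightarrow> bool" where
  "dedekind_complete V \<longleftrightarrow>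
     (\<forall>A. A \<subseteq> carrier V \<and> A \<noteq> {} \<and> (\<exists>u\<in>carrier V. \<forall>a\<in>A. leq V a u) \<longrightarrow> (\<exists>s. is_sup V A s))"

text \<open>For positive \<open>a\<close> and \<open>b\<close>, disjointness is \<open>a \<and> b = 0\<close>.\<close>

definition laterally_complete :: "('v, 'm) ordered_space_scheme \<Rightarrow> bool" where
  "laterally_complete V \<longleftrightarrow>
     (\<forall>A. A \<subseteq> carrier V \<and> A \<noteq> {} \<and> (\<forall>a\<in>A. leq V (zero V) a) \<and>
        (\<forall>a\<in>A. \<forall>b\<in>A. a \<noteq> b \<longrightarrow> is_inf V {a, b} (zero V)) \<longrightarrow> (\<exists>s. is_sup V A s))"

definition universally_complete :: "('v, 'm) ordered_space_scheme \<Rightarrow> bool" where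
  "universally_complete V \<longleftrightarrow> riesz_space V \<and> dedekind_complete V \<and> laterally_complete V"

definition riesz_embedding ::
  "('v, 'm) ordered_space_scheme \<Rightarrow> ('w, 'n) ordered_space_scheme \<Rightarrow> ('v \<Rightarrow> 'w) \<Rightarrow> bool" where
  "riesz_embedding V W \<mu> \<longleftrightarrow>
     \<mu> ` carrier V \<subseteq> carrier W \<and> inj_on \<mu> (carrier V) \<and>
     (\<forall>x\<in>carrier V. \<forall>y\<in>carrier V. \<mu> (add V x y) = add W (\<mu> x) (\<mu> y)) \<and>
     (\<forall>c. \<forall>x\<in>carrier V. \<mu> (scale V c x) = scale W c (\<mu> x)) \<and>
     (\<forall>x\<in>carrier V. \<forall>y\<in>carrier V. \<forall>s. is_sup V {x, y} s \<longrightarrow> is_sup W {\<mu> x, \<mu> y} (\<mu> s)) \<and>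
     (\<forall>x\<in>carrier V. \<forall>y\<in>carrier V. \<forall>s. is_inf V {x, y} s \<longrightarrow> is_inf W {\<mu> x, \<mu> y} (\<mu> s))"

definition universal_completion ::
  "('v, 'm) ordered_space_scheme \<Rightarrow> ('w, 'n) ordered_space_scheme \<Rightarrow> ('v \<Rightarrow> 'w) \<Rightarrow> bool" where
  "universal_completion R U \<mu> \<longleftrightarrow>
     riesz_space R \<and> universally_complete U \<and> riesz_embedding R U \<mu> \<and>
     (\<forall>f\<in>carrier U. leq U (zero U) f \<longrightarrow>
        is_sup U {\<mu> g | g. g \<in> carrier R \<and> leq U (zero U) (\<mu> g) \<and> leq U (\<mu> g) f} f)"


section \<open>Continuous and nearly finite Hausdorff continuous functions on a frame\<close>

definition IC_set :: "(IR \<Rightarrow> 'a::frame) set" where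
  "IC_set = {f. frame_hom f}"

definition IC_le :: "(IR \<Rightarrow> 'a::frame) \<Rightarrow> (IR \<Rightarrow> 'a) \<Rightarrow> bool" where
  "IC_le f g \<longleftrightarrow> (\<forall>p. f (above_gen p) \<le> g (above_gen p)) \<and> (\<forall>q. g (below_gen q) \<le> f (below_gen q))"

text \<open>
  Continuous real functions are the homomorphisms out of the frame presented by (r1), (r3), (r4)
  which also respect (r2), (r5) and (r6); so \<open>C_set\<close> is a subset of \<open>IC_set\<close>.
\<close>

definition C_set :: "(IR \<Rightarrow> 'a::frame) set" where
  "C_set = {f \<in> IC_set.
     (\<forall>p q. p < q \<longrightarrow> f (above_gen p) \<squnion> f (below_gen q) = top) \<and>
     (\<Squnion>p. f (above_gen p)) = top \<and> (\<Squnion>p. f (below_gen p)) = top}"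

text \<open>
  On elements of \<open>C_set\<close> the prescribed values below respect the defining relations, so that
  \<open>IR_ext\<close> yields a homomorphism by \<open>IR_universal\<close>; elsewhere the operations are junk.
\<close>

definition C_zero :: "IR \<Rightarrow> 'a::frame" where
  "C_zero = IR_ext (\<lambda>p. if p < 0 then top else bot) (\<lambda>q. if 0 < q then top else bot)"

definition C_add :: "(IR \<Rightarrow> 'a::frame) \<Rightarrow> (IR \<Rightarrow> 'a) \<Rightarrow> IR \<Rightarrow> 'a" where
  "C_add f g = IR_ext (\<lambda>p. \<Squnion>r. f (above_gen r) \<sqinter> g (above_gen (p - r)))
                      (\<lambda>q. \<Squnion>s. f (below_gen s) \<sqinter> g (below_gen (q - s)))"

definition C_minus :: "(IR \<Rightarrow> 'a::frame) \<Rightarrow> IR \<Rightarrow> 'a" where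
  "C_minus f = IR_ext (\<lambda>p. f (below_gen (- p))) (\<lambda>q. f (above_gen (- q)))"

definition C_scale_pos :: "real \<Rightarrow> (IR \<Rightarrow> 'a::frame) \<Rightarrow> IR \<Rightarrow> 'a" where
  "C_scale_pos c f = IR_ext (\<lambda>p. \<Squnion>{f (above_gen r) | r. c * of_rat r > of_rat p})
                            (\<lambda>q. \<Squnion>{f (below_gen s) | s. c * of_rat s < of_rat q})"

definition C_scale :: "real \<Rightarrow> (IR \<Rightarrow> 'a::frame) \<Rightarrow> IR \<Rightarrow> 'a" where
  "C_scale c f = (if c > 0 then C_scale_pos c f
                  else if c = 0 then C_zero else C_minus (C_scale_pos (- c) f))"

definition C_space :: "(IR \<Rightarrow> 'a::frame) ordered_space" where
  "C_space = \<lparr>carrier = C_set, leq = IC_le, zero = C_zero, add = C_add, scale = C_scale\<rparr>"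

definition hausdorff_continuous :: "(IR \<Rightarrow> 'a::frame) \<Rightarrow> bool" where
  "hausdorff_continuous f \<longleftrightarrow> f \<in> IC_set \<and>
     (\<forall>p q. p < q \<longrightarrow> pcompl (f (above_gen p)) \<le> f (below_gen q) \<and> pcompl (f (below_gen q)) \<le> f (above_gen p))"

definition nearly_finite :: "(IR \<Rightarrow> 'a::frame) \<Rightarrow> bool" where
  "nearly_finite f \<longleftrightarrow>
     pcompl (pcompl (\<Squnion>p. f (above_gen p))) = top \<and> pcompl (pcompl (\<Squnion>q. f (below_gen q))) = top"

definition Hnf_set :: "(IR \<Rightarrow> 'a::frame) set" where
  "Hnf_set = {f. hausdorff_continuous f \<and> nearly_finite f}"

definition Gamma :: "(IR \<Rightarrow> 'a::frame) \<Rightarrow> IR \<Rightarrow> 'a booln" where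
  "Gamma f = beta \<circ> f"

text \<open>The joins are taken in \<open>'a\<close>, not in \<open>'a booln\<close>.\<close>

definition Delta :: "(IR \<Rightarrow> 'a::frame booln) \<Rightarrow> IR \<Rightarrow> 'a" where
  "Delta g = IR_ext (\<lambda>p. \<Squnion>r\<in>{p<..}. Rep_booln (g (above_gen r)))
                    (\<lambda>q. \<Squnion>s\<in>{..<q}. Rep_booln (g (below_gen s)))"

text \<open>
  The linear structure is transported along \<open>Gamma\<close> and \<open>Delta\<close>; the order is that of
  \<open>IC_set\<close>.
\<close>

definition Hnf_space :: "(IR \<Rightarrow> 'a::frame) ordered_space" where
  "Hnf_space = \<lparr>carrier = Hnf_set, leq = IC_le, zero = Delta C_zero,
     add = (\<lambda>f g. Delta (C_add (Gamma f) (Gamma g))),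
     scale = (\<lambda>c f. Delta (C_scale c (Gamma f)))\<rparr>"

end

theory Submission
  imports Defs
begin

text \<open>
  Although \<open>L\<close> need not be spatial, finitely many elements of \<open>C(L)\<close> always have real values at
  enough prime filters of \<open>L\<close> to separate elements: since \<open>\<Or>\<^sub>p f(p,-) = \<Or>\<^sub>q f(-,q) = 1\<close>, any
  \<open>x \<nleq> y\<close> can be shrunk to a smaller \<open>x' \<nleq> y\<close> below some \<open>f(p,-) \<and> f(-,q)\<close> for each of the
  \<open>f\<close> involved, and a prime filter separating \<open>x'\<close> from \<open>y\<close> assigns a real number to each \<open>f\<close>.
  The operations act on these values as in the reals, so the Riesz space laws of \<open>C(L)\<close> are laws
  of the reals. This applies to the Booleanization as well, and \<open>Gamma\<close>, \<open>Delta\<close> carry the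
  structure over to the nearly finite Hausdorff continuous functions.

  Over a Boolean frame the pointwise join of a family is again a real function as soon as it is
  finite, i.e. \<open>\<Or>\<^sub>p (\<Or>\<^sub>f f(p,-))\<^sup>* = 1\<close>; this holds for bounded families and for disjoint ones.
  Density is Urysohn's lemma: for \<open>0 \<le> p < r\<close>, \<open>f(r,-)\<close> is a join of elements \<open>a\<close> completely below
  it, and each of them carries a continuous function between \<open>0\<close> and \<open>f\<close> with value \<open>r\<close> on \<open>a\<close>.
\<close>


\<comment> \<open>Finite and infinite distributivity in frames\<close>
subclass (in frame) distrib_lattice
proof
  fix x y z :: 'a
  have "inf a (sup b c) = sup (inf a b) (inf a c)" for a b c :: 'a
    using inf_Sup_distrib[of a "{b, c}"] by simp
  then show "sup x (inf y z) = inf (sup x y) (sup x z)"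
    by (rule distrib_imp1)
qed

lemma inf_SUP: "(a :: 'a::frame) \<sqinter> (\<Squnion>i\<in>I. F i) = (\<Squnion>i\<in>I. a \<sqinter> F i)"
  by (simp add: inf_Sup_distrib image_image)

lemma SUP_inf: "(\<Squnion>i\<in>I. F i) \<sqinter> (a :: 'a::frame) = (\<Squnion>i\<in>I. F i \<sqinter> a)"
  by (simp add: inf_SUP inf_commute[of _ a])

lemma SUP_inf_SUP_le:
  fixes c :: "'a::frame"
  assumes "\<And>i j. i \<in> I \<Longrightarrow> j \<in> J \<Longrightarrow> F i \<sqinter> G j \<le> c"
  shows "(\<Squnion>i\<in>I. F i) \<sqinter> (\<Squnion>j\<in>J. G j) \<le> c"
  using assms by (auto simp: inf_SUP SUP_inf intro!: SUP_least)

text \<open>The form in which (r2) is exploited throughout: a disjointness becomes an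
  inequality.\<close>

lemma le_of_inf_sup_top:
  fixes a b c :: "'a::frame"
  assumes "a \<squnion> b = top" "c \<sqinter> a = bot"
  shows "c \<le> b"
proof -
  have "c = c \<sqinter> (a \<squnion> b)" using assms by simp
  also have "\<dots> = c \<sqinter> b" using assms(2) by (simp add: inf_sup_distrib1)
  finally show ?thesis by (metis inf_le2)
qed


section \<open>The prime filter theorem\<close>

section \<open>Prime filters\<close>

text \<open>Primeness concerns binary joins only. Such filters abound even when the frame has no
  points, at the price that infinite joins such as those of (r3) and (r5) need not be
  respected.\<close>

definition prime_filter :: "'a::frame set \<Rightarrow> bool" where
  "prime_filter P \<longleftrightarrow> top \<in> P \<and> bot \<notin> P \<and> (\<forall>a\<in>P. \<forall>b. a \<le> b \<longrightarrow> b \<in> P) \<and>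
     (\<forall>a\<in>P. \<forall>b\<in>P. a \<sqinter> b \<in> P) \<and> (\<forall>a b. a \<squnion> b \<in> P \<longrightarrow> a \<in> P \<or> b \<in> P)"

lemma prime_filterD:
  assumes "prime_filter P"
  shows "top \<in> P" "bot \<notin> P" "a \<in> P \<Longrightarrow> a \<le> b \<Longrightarrow> b \<in> P"
    "a \<in> P \<Longrightarrow> b \<in> P \<Longrightarrow> a \<sqinter> b \<in> P" "a \<squnion> b \<in> P \<Longrightarrow> a \<in> P \<or> b \<in> P"
  using assms unfolding prime_filter_def by blast+

text \<open>By Zorn's lemma there is a filter maximal among those that contain \<open>x\<close> and
  avoid \<open>y\<close>; distributivity makes it prime.\<close>

lemma prime_filter_separates:
  fixes x y :: "'a::frame"
  assumes "\<not> x \<le> y"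
  obtains P where "prime_filter P" "x \<in> P" "y \<notin> P"
proof -
  define \<F> where "\<F> = {F :: 'a set. x \<in> F \<and> y \<notin> F \<and> (\<forall>a\<in>F. \<forall>b. a \<le> b \<longrightarrow> b \<in> F) \<and>
    (\<forall>a\<in>F. \<forall>b\<in>F. a \<sqinter> b \<in> F)}"
  have "\<exists>M\<in>\<F>. \<forall>F\<in>\<F>. M \<subseteq> F \<longrightarrow> F = M"
  proof (rule subset_Zorn_nonempty)
    have "{x..} \<in> \<F>" using assms by (auto simp: \<F>_def)
    then show "\<F> \<noteq> {}" by blast
  next
    fix \<C> assume C: "\<C> \<noteq> {}" "subset.chain \<F> \<C>"
    then have tot: "F \<subseteq> G \<or> G \<subseteq> F" if "F \<in> \<C>" "G \<in> \<C>" for F G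
      using that by (auto simp: subset.chain_def)
    have "a \<sqinter> b \<in> \<Union>\<C>" if ab: "a \<in> \<Union>\<C>" "b \<in> \<Union>\<C>" for a b
    proof -
      obtain F G where "F \<in> \<C>" "G \<in> \<C>" "a \<in> F" "b \<in> G" using ab by blast
      then obtain H where "H \<in> \<C>" "a \<in> H" "b \<in> H" using tot by blast
      moreover have "H \<in> \<F>" using \<open>H \<in> \<C>\<close> C by (auto simp: subset.chain_def)
      ultimately show ?thesis by (auto simp: \<F>_def)
    qed
    moreover have "\<forall>F\<in>\<C>. x \<in> F \<and> y \<notin> F \<and> (\<forall>a\<in>F. \<forall>b. a \<le> b \<longrightarrow> b \<in> F)"
      using C by (auto simp: \<F>_def subset.chain_def)
    ultimately show "\<Union>\<C> \<in> \<F>" using C(1) unfolding \<F>_def by blast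
  qed
  then obtain M where M: "M \<in> \<F>" and max: "\<And>F. F \<in> \<F> \<Longrightarrow> M \<subseteq> F \<Longrightarrow> F = M" by blast
  have x: "x \<in> M" and y: "y \<notin> M" and up: "\<And>a b. a \<in> M \<Longrightarrow> a \<le> b \<Longrightarrow> b \<in> M"
    and inf: "\<And>a b. a \<in> M \<Longrightarrow> b \<in> M \<Longrightarrow> a \<sqinter> b \<in> M"
    using M by (auto simp: \<F>_def)
  have ex: "\<exists>m\<in>M. m \<sqinter> a \<le> y" if "a \<notin> M" for a
  proof (rule ccontr)
    assume no: "\<not> ?thesis"
    \<comment> \<open>The filter generated by \<open>M\<close> and \<open>a\<close>. Since it avoids
      \<open>y\<close>, maximality would put \<open>a\<close> into \<open>M\<close>.\<close>
    define F where "F = {c. \<exists>m\<in>M. m \<sqinter> a \<le> c}"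
    have "a' \<sqinter> b' \<in> F" if a': "a' \<in> F" and b': "b' \<in> F" for a' b'
    proof -
      obtain m n where "m \<in> M" "n \<in> M" "m \<sqinter> a \<le> a'" "n \<sqinter> a \<le> b'" using a' b' by (auto simp: F_def)
      moreover have "m \<sqinter> n \<sqinter> a = (m \<sqinter> a) \<sqinter> (n \<sqinter> a)" by (simp add: ac_simps)
      ultimately have "m \<sqinter> n \<in> M" "m \<sqinter> n \<sqinter> a \<le> a' \<sqinter> b'"
        using inf by (auto simp only: intro: inf_mono)
      then show ?thesis by (auto simp: F_def)
    qed
    moreover have "x \<in> F" "y \<notin> F" "\<forall>c\<in>F. \<forall>b. c \<le> b \<longrightarrow> b \<in> F" "M \<subseteq> F" "a \<in> F"
      using x no by (auto simp: F_def intro: order.trans le_infI1)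
    ultimately show False using max[of F] \<open>a \<notin> M\<close> by (auto simp: \<F>_def)
  qed
  have "a \<in> M \<or> b \<in> M" if "a \<squnion> b \<in> M" for a b
  proof (rule ccontr)
    assume "\<not> ?thesis"
    then obtain m n where mn: "m \<in> M" "n \<in> M" and le: "m \<sqinter> a \<le> y" "n \<sqinter> b \<le> y" using ex by blast
    have "m \<sqinter> n \<sqinter> (a \<squnion> b) \<in> M" using mn that inf by blast
    moreover have "m \<sqinter> n \<sqinter> (a \<squnion> b) \<le> y"
    proof -
      have "m \<sqinter> n \<sqinter> a \<le> m \<sqinter> a" "m \<sqinter> n \<sqinter> b \<le> n \<sqinter> b" by (simp_all add: le_infI1)
      from this[THEN order.trans] le show ?thesis by (simp add: inf_sup_distrib1)
    qed
    ultimately show False using up y by blast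
  qed
  then have "prime_filter M"
    unfolding prime_filter_def using x y up inf by (meson bot_least top_greatest)
  then show ?thesis using that x y by blast
qed


section \<open>Real functions prescribed by their values on the generators\<close>

section \<open>Homomorphisms on the generators\<close>

lemma hom_inf: "frame_hom f \<Longrightarrow> f (a \<sqinter> b) = f a \<sqinter> f b"
  and hom_Sup: "frame_hom f \<Longrightarrow> f (\<Squnion>A) = (\<Squnion>a\<in>A. f a)"
  and hom_top: "frame_hom f \<Longrightarrow> f top = top"
  by (auto simp: frame_hom_def)

lemma hom_bot: "frame_hom f \<Longrightarrow> f bot = bot"
  using hom_Sup[of f "{}"] by simp

lemma hom_r1: "frame_hom f \<Longrightarrow> q \<le> p \<Longrightarrow> f (above_gen p) \<sqinter> f (below_gen q) = bot"
  by (simp add: hom_inf[symmetric] IR_r1 hom_bot)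

lemma hom_r3: "frame_hom f \<Longrightarrow> f (above_gen p) = (\<Squnion>q\<in>{p<..}. f (above_gen q))"
  by (subst IR_r3) (simp add: hom_Sup image_image)

lemma hom_r4: "frame_hom f \<Longrightarrow> f (below_gen q) = (\<Squnion>p\<in>{..<q}. f (below_gen p))"
  by (subst IR_r4) (simp add: hom_Sup image_image)

lemma hom_above_antimono: "frame_hom f \<Longrightarrow> p \<le> q \<Longrightarrow> f (above_gen q) \<le> f (above_gen p)"
  by (cases "p = q") (auto simp: hom_r3[of f p] intro: SUP_upper)

lemma hom_below_mono: "frame_hom f \<Longrightarrow> p \<le> q \<Longrightarrow> f (below_gen p) \<le> f (below_gen q)"
  by (cases "p = q") (auto simp: hom_r4[of f q] intro: SUP_upper)

text \<open>The uniqueness half of \<open>IR_universal\<close>, applied to the generator values of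
  \<open>g\<close>.\<close>

lemma hom_eqI:
  assumes "frame_hom f" "frame_hom g"
    and "\<And>p. f (above_gen p) = g (above_gen p)" "\<And>q. f (below_gen q) = g (below_gen q)"
  shows "f = g"
proof -
  have "\<exists>!h. frame_hom h \<and> (\<forall>p. h (above_gen p) = g (above_gen p)) \<and>
      (\<forall>q. h (below_gen q) = g (below_gen q))"
    by (intro IR_universal hom_r1 hom_r3 hom_r4 assms)
  then show ?thesis using assms by (elim ex1E) metis
qed

text \<open>
  Relations (r1), (r3) and (r4), the last two split into monotonicity and the nontrivial inequality.
\<close>

definition gen_values :: "(rat \<Rightarrow> 'a::frame) \<Rightarrow> (rat \<Rightarrow> 'a) \<Rightarrow> bool" where
  "gen_values u d \<longleftrightarrow> (\<forall>p q. q \<le> p \<longrightarrow> u p \<sqinter> d q = bot) \<and>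
     antimono u \<and> (\<forall>p. u p \<le> (\<Squnion>q\<in>{p<..}. u q)) \<and>
     mono d \<and> (\<forall>q. d q \<le> (\<Squnion>p\<in>{..<q}. d p))"

lemma IR_ext:
  assumes "gen_values u d"
  shows IR_ext_hom: "frame_hom (IR_ext u d)"
    and IR_ext_above: "IR_ext u d (above_gen p) = u p"
    and IR_ext_below: "IR_ext u d (below_gen q) = d q"
proof -
  have r34: "u p = (\<Squnion>q\<in>{p<..}. u q)" "d q = (\<Squnion>p\<in>{..<q}. d p)" for p q
    using assms by (auto simp: gen_values_def antimono_def mono_def intro!: order.antisym SUP_least)
  have "\<exists>!h. frame_hom h \<and> (\<forall>p. h (above_gen p) = u p) \<and> (\<forall>q. h (below_gen q) = d q)"
    by (rule IR_universal[OF _ r34]) (use assms in \<open>simp add: gen_values_def\<close>)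
  from theI'[OF this] show "frame_hom (IR_ext u d)" "IR_ext u d (above_gen p) = u p"
    "IR_ext u d (below_gen q) = d q"
    by (auto simp: IR_ext_def)
qed

text \<open>All of (r1) to (r6), stated for families of elements so that they can be checked before
  the homomorphism exists.\<close>

definition real_values :: "(rat \<Rightarrow> 'a::frame) \<Rightarrow> (rat \<Rightarrow> 'a) \<Rightarrow> bool" where
  "real_values u d \<longleftrightarrow> gen_values u d \<and> (\<forall>p q. p < q \<longrightarrow> u p \<squnion> d q = top) \<and>
     (\<Squnion>p. u p) = top \<and> (\<Squnion>q. d q) = top"

lemma real_valuesI:
  assumes "\<And>p q. q \<le> p \<Longrightarrow> u p \<sqinter> d q = bot"
    and "\<And>p q. p < q \<Longrightarrow> u p \<squnion> d q = top"
    and "\<And>p q. p \<le> q \<Longrightarrow> u q \<le> u p" "\<And>p. u p \<le> (\<Squnion>q\<in>{p<..}. u q)"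
    and "\<And>p q. p \<le> q \<Longrightarrow> d p \<le> d q" "\<And>q. d q \<le> (\<Squnion>p\<in>{..<q}. d p)"
    and "top \<le> (\<Squnion>p. u p)" "top \<le> (\<Squnion>q. d q)"
  shows "real_values u d"
  using assms by (auto simp: real_values_def gen_values_def antimono_def mono_def top_unique)

lemma real_values_gen_values: "real_values u d \<Longrightarrow> gen_values u d"
  by (simp add: real_values_def)

lemma IR_ext_in_C_set: "real_values u d \<Longrightarrow> IR_ext u d \<in> C_set"
  by (simp add: real_values_def C_set_def IC_set_def IR_ext)

lemma C_set_hom: "f \<in> C_set \<Longrightarrow> frame_hom f"
  by (simp add: C_set_def IC_set_def)

lemma C_setD:
  assumes "f \<in> C_set"
  shows "p < q \<Longrightarrow> f (above_gen p) \<squnion> f (below_gen q) = top"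
    "(\<Squnion>p. f (above_gen p)) = top" "(\<Squnion>p. f (below_gen p)) = top"
  using assms by (auto simp: C_set_def)


section \<open>Real numbers at prime filters, and the transfer principle\<close>

section \<open>Values at prime filters\<close>

text \<open>The cut that \<open>P\<close> induces on the rationals. At a rational \<open>x\<close>
  the membership of f(x,-) and f(-,x) is left open, since \<open>P\<close> need not respect the
  infinite joins in (r3) and (r4).\<close>

definition has_value :: "'a::frame set \<Rightarrow> (IR \<Rightarrow> 'a) \<Rightarrow> real \<Rightarrow> bool" where
  "has_value P f x \<longleftrightarrow> (\<forall>p. of_rat p < x \<longrightarrow> f (above_gen p) \<in> P) \<and>
     (\<forall>q. x < of_rat q \<longrightarrow> f (below_gen q) \<in> P)"

text \<open>The value is the supremum of the \<open>p\<close> with f(p,-) in \<open>P\<close>. The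
  rationals \<open>a\<close> and \<open>b\<close> make this set nonempty and bounded, which (r5) and
  (r6) alone would not, their joins being infinite.\<close>

lemma has_value_exists:
  assumes f: "f \<in> C_set" and P: "prime_filter P"
    and a: "f (above_gen a) \<in> P" and b: "f (below_gen b) \<in> P"
  shows "\<exists>x. has_value P f x"
proof -
  define S where "S = {of_rat p :: real | p. f (above_gen p) \<in> P}"
  note hom = C_set_hom[OF f]
  have less: "p < q" if "f (above_gen p) \<in> P" "f (below_gen q) \<in> P" for p q
    using hom_r1[OF hom, of q p] prime_filterD(2)[OF P] prime_filterD(4)[OF P that] by force
  have bdd: "bdd_above S"
    by (rule bdd_aboveI[of _ "of_rat b"]) (auto simp: S_def of_rat_less_eq dest!: less[OF _ b])
  have "f (above_gen p) \<in> P" if p: "of_rat p < Sup S" for p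
  proof -
    have "S \<noteq> {}" using a by (auto simp: S_def)
    then obtain z where "z \<in> S" "of_rat p < z" using p less_cSup_iff[OF _ bdd] by blast
    then obtain q where "f (above_gen q) \<in> P" "p < q" by (auto simp: S_def of_rat_less)
    then show ?thesis
      using prime_filterD(3)[OF P] hom_above_antimono[OF hom, of p q] by simp
  qed
  moreover have "f (below_gen q) \<in> P" if q: "Sup S < of_rat q" for q
  proof -
    \<comment> \<open>As \<open>p\<close> exceeds the supremum, f(p,-) lies outside
      \<open>P\<close>, and primeness applied to (r2) for \<open>p < q\<close> selects
      f(-,q).\<close>
    obtain p where p: "Sup S < of_rat p" "p < q" using of_rat_dense[OF q] by (auto simp: of_rat_less)
    have "f (above_gen p) \<notin> P"
    proof
      assume "f (above_gen p) \<in> P"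
      then have "of_rat p \<le> Sup S" by (intro cSup_upper bdd) (auto simp: S_def)
      then show False using p by simp
    qed
    moreover have "f (above_gen p) \<squnion> f (below_gen q) \<in> P"
      using C_setD(1)[OF f p(2)] prime_filterD(1)[OF P] by simp
    ultimately show ?thesis using prime_filterD(5)[OF P] by blast
  qed
  ultimately show ?thesis unfolding has_value_def by blast
qed

text \<open>Induction on \<open>A\<close> shrinks \<open>x\<close> until it lies below some f(p,-)
  and some f(-,q) for every \<open>f\<close>; a prime filter containing the shrunk element then
  meets the hypotheses of \<open>has_value_exists\<close>.\<close>

lemma finite_values:
  assumes "finite A" "A \<subseteq> C_set" "\<not> x \<le> y"
  obtains P where "prime_filter P" "x \<in> P" "y \<notin> P" "\<forall>f\<in>A. \<exists>v. has_value P f v"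
proof -
  have "\<exists>z\<le>x. \<not> z \<le> y \<and> (\<forall>f\<in>A. (\<exists>p. z \<le> f (above_gen p)) \<and> (\<exists>q. z \<le> f (below_gen q)))"
    using assms
  proof (induction A)
    case empty
    then show ?case by auto
  next
    case (insert f A)
    then obtain z where z: "z \<le> x" "\<not> z \<le> y"
      "\<forall>f\<in>A. (\<exists>p. z \<le> f (above_gen p)) \<and> (\<exists>q. z \<le> f (below_gen q))" by auto
    \<comment> \<open>By (r5) and (r6), \<open>z\<close> is the join of its meets with f(p,-) and
      f(-,q), so one of these meets is still not below \<open>y\<close>.\<close>
    have "z = z \<sqinter> (\<Squnion>p. f (above_gen p)) \<sqinter> (\<Squnion>q. f (below_gen q))"
      using insert.prems C_setD(2,3)[of f] by simp
    also have "\<dots> = (\<Squnion>q. \<Squnion>p. z \<sqinter> f (above_gen p) \<sqinter> f (below_gen q))"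
      by (simp add: inf_SUP SUP_inf)
    finally have "\<exists>p q. \<not> z \<sqinter> f (above_gen p) \<sqinter> f (below_gen q) \<le> y"
      using z(2) by (metis (mono_tags, lifting) SUP_least)
    then obtain p q where pq: "\<not> z \<sqinter> f (above_gen p) \<sqinter> f (below_gen q) \<le> y" by blast
    define w where "w = z \<sqinter> f (above_gen p) \<sqinter> f (below_gen q)"
    have w: "w \<le> z" "w \<le> f (above_gen p)" "w \<le> f (below_gen q)"
      by (simp_all add: w_def le_infI1)
    have "\<forall>h\<in>insert f A. (\<exists>p. w \<le> h (above_gen p)) \<and> (\<exists>q. w \<le> h (below_gen q))"
      using w z(3) order.trans[OF w(1)] by (metis insert_iff)
    moreover have "w \<le> x" using w(1) z(1) by (rule order.trans)
    moreover have "\<not> w \<le> y" using pq by (simp add: w_def)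
    ultimately show ?case by blast
  qed
  then obtain z where z: "z \<le> x" "\<not> z \<le> y"
    "\<forall>f\<in>A. (\<exists>p. z \<le> f (above_gen p)) \<and> (\<exists>q. z \<le> f (below_gen q))" by blast
  obtain P where P: "prime_filter P" "z \<in> P" "y \<notin> P" using prime_filter_separates[OF z(2)] .
  have "\<exists>v. has_value P f v" if "f \<in> A" for f
  proof -
    have "\<exists>p q. f (above_gen p) \<in> P \<and> f (below_gen q) \<in> P"
      using that z(3) prime_filterD(3)[OF P(1,2)] by blast
    then show ?thesis using has_value_exists[of f P] that assms(2) P(1) by blast
  qed
  then show ?thesis using that P prime_filterD(3)[OF P(1,2) z(1)] by blast
qed

text \<open>Serves to check (r2) for sums and multiples, before the corresponding function has been
  constructed.\<close>

lemma top_by_values: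
  assumes "finite A" "A \<subseteq> C_set"
    and "\<And>P. prime_filter P \<Longrightarrow> \<forall>f\<in>A. \<exists>v. has_value P f v \<Longrightarrow> x \<in> P"
  shows "x = top"
  using finite_values[of A top x] assms by (metis top_unique)

lemma has_value_le:
  assumes "frame_hom g" "prime_filter P" "has_value P f x" "has_value P g y" "IC_le f g"
  shows "x \<le> y"
proof (rule ccontr)
  assume "\<not> x \<le> y"
  then obtain q where q: "y < of_rat q" "of_rat q < x" using of_rat_dense[of y x] by auto
  then have "f (above_gen q) \<in> P" "g (below_gen q) \<in> P" using assms by (auto simp: has_value_def)
  moreover from this have "g (above_gen q) \<in> P"
    using assms prime_filterD(3) unfolding IC_le_def by blast
  ultimately show False using hom_r1[of g q q] prime_filterD(2,4)[OF assms(2)] assms(1)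
    by (metis order_refl)
qed

text \<open>g(-,s) is disjoint from f(s,-) \<le> g(s,-), and (r2) for \<open>f\<close> puts it below
  f(-,q) whenever \<open>s < q\<close>. As (r2) is asked of \<open>f\<close> alone, \<open>g\<close>
  may be a Hausdorff continuous function.\<close>

lemma IC_le_C_set_iff:
  assumes f: "f \<in> C_set" and g: "frame_hom g"
  shows "IC_le f g \<longleftrightarrow> (\<forall>p. f (above_gen p) \<le> g (above_gen p))"
proof -
  have "g (below_gen q) \<le> f (below_gen q)" if le: "\<forall>p. f (above_gen p) \<le> g (above_gen p)" for q
  proof (subst hom_r4[OF g], rule SUP_least)
    fix s assume "s \<in> {..<q}"
    then have 1: "f (above_gen s) \<squnion> f (below_gen q) = top" using C_setD(1)[OF f] by simp
    have "g (below_gen s) \<sqinter> f (above_gen s) \<le> g (above_gen s) \<sqinter> g (below_gen s)"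
      using le by (simp add: le_infI2)
    then have "g (below_gen s) \<sqinter> f (above_gen s) = bot"
      using hom_r1[OF g, of s s] by (simp add: bot_unique)
    with 1 show "g (below_gen s) \<le> f (below_gen q)" by (rule le_of_inf_sup_top)
  qed
  then show ?thesis by (auto simp: IC_le_def)
qed

text \<open>The transfer principle: \<open>A\<close> holds the variables, \<open>f\<close> and
  \<open>g\<close> are terms in them. If the inequality fails, some f(r,-) \<sqinter> g(-,q) with
  \<open>q < r\<close> is nonzero; at a prime filter containing it the value of \<open>f\<close> is
  at least \<open>r\<close> and that of \<open>g\<close> at most \<open>q\<close>.\<close>

lemma IC_le_by_values:
  assumes A: "finite A" "A \<subseteq> C_set" and f: "f \<in> C_set" and g: "g \<in> C_set"
    and le: "\<And>P. prime_filter P \<Longrightarrow> \<forall>h\<in>A. \<exists>v. has_value P h v \<Longrightarrow>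
      \<exists>x y. has_value P f x \<and> has_value P g y \<and> x \<le> y"
  shows "IC_le f g"
proof (rule ccontr)
  note hf = C_set_hom[OF f]
  note hg = C_set_hom[OF g]
  assume "\<not> ?thesis"
  then obtain p where "\<not> f (above_gen p) \<le> g (above_gen p)"
    using f g by (auto simp: IC_le_C_set_iff C_set_hom)
  then obtain r where r: "r > p" "\<not> f (above_gen r) \<le> g (above_gen p)"
    by (subst (asm) hom_r3[OF hf]) (auto simp: SUP_le_iff)
  \<comment> \<open>The room between \<open>q\<close> and \<open>r\<close> yields
    \<open>y \<le> q < r \<le> x\<close> at the end, whatever happens at \<open>q\<close> and
    \<open>r\<close> themselves.\<close>
  obtain q where q: "p < q" "q < r" using r(1) dense by blast
  have nle: "\<not> f (above_gen r) \<sqinter> g (below_gen q) \<le> bot"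
  proof
    assume *: "f (above_gen r) \<sqinter> g (below_gen q) \<le> bot"
    have "g (below_gen q) \<squnion> g (above_gen p) = top" using C_setD(1)[OF g q(1)] by (simp add: sup_commute)
    then have "f (above_gen r) \<le> g (above_gen p)"
      by (rule le_of_inf_sup_top) (use * in \<open>simp add: bot_unique\<close>)
    then show False using r by simp
  qed
  obtain P where P: "prime_filter P" "f (above_gen r) \<sqinter> g (below_gen q) \<in> P" "bot \<notin> P"
    "\<forall>h\<in>A. \<exists>v. has_value P h v"
    using finite_values[OF A nle] .
  obtain x y where xy: "has_value P f x" "has_value P g y" "x \<le> y" using le[OF P(1,4)] by blast
  have inP: "f (above_gen r) \<in> P" "g (below_gen q) \<in> P"
    using prime_filterD(3)[OF P(1,2)] by auto
  have "\<not> x < of_rat r"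
  proof
    assume "x < of_rat r"
    then have "f (below_gen r) \<in> P" using xy by (auto simp: has_value_def)
    then show False using inP(1) hom_r1[OF hf, of r r] prime_filterD(2,4)[OF P(1)] by (metis order_refl)
  qed
  moreover have "\<not> of_rat q < y"
  proof
    assume "of_rat q < y"
    then have "g (above_gen q) \<in> P" using xy by (auto simp: has_value_def)
    then show False using inP(2) hom_r1[OF hg, of q q] prime_filterD(2,4)[OF P(1)] by (metis order_refl)
  qed
  moreover have "(of_rat q :: real) < of_rat r" using q by (simp add: of_rat_less)
  ultimately show False using xy(3) by linarith
qed

lemma IC_le_antisym: "frame_hom f \<Longrightarrow> frame_hom g \<Longrightarrow> IC_le f g \<Longrightarrow> IC_le g f \<Longrightarrow> f = g"
  by (intro hom_eqI) (auto simp: IC_le_def intro: order.antisym)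

lemma C_eq_by_values:
  assumes "finite A" "A \<subseteq> C_set" "f \<in> C_set" "g \<in> C_set"
    and "\<And>P. prime_filter P \<Longrightarrow> \<forall>h\<in>A. \<exists>v. has_value P h v \<Longrightarrow>
      \<exists>x. has_value P f x \<and> has_value P g x"
  shows "f = g"
proof (rule IC_le_antisym)
  show "IC_le f g" "IC_le g f"
    using assms by (intro IC_le_by_values[OF assms(1,2)]; blast)+
qed (use assms in \<open>simp_all add: C_set_hom\<close>)


section \<open>The operations, and (r1) to (r6) for their values\<close>

section \<open>Operations on continuous functions\<close>

definition C_sup :: "(IR \<Rightarrow> 'a::frame) \<Rightarrow> (IR \<Rightarrow> 'a) \<Rightarrow> IR \<Rightarrow> 'a" where
  "C_sup f g = IR_ext (\<lambda>p. f (above_gen p) \<squnion> g (above_gen p)) (\<lambda>q. f (below_gen q) \<sqinter> g (below_gen q))"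

text \<open>Passing through negation spares a second verification of (r1) to (r6).\<close>

definition C_inf :: "(IR \<Rightarrow> 'a::frame) \<Rightarrow> (IR \<Rightarrow> 'a) \<Rightarrow> IR \<Rightarrow> 'a" where
  "C_inf f g = C_minus (C_sup (C_minus f) (C_minus g))"

lemma real_values_zero:
  "real_values (\<lambda>p. if p < 0 then top else bot :: 'a::frame) (\<lambda>q. if 0 < q then top else bot)"
proof (rule real_valuesI)
  show "(if p < 0 then top else bot :: 'a) \<le> (\<Squnion>q\<in>{p<..}. if q < 0 then top else bot)" for p :: rat
  proof (cases "p < 0")
    case True
    then obtain z where "p < z" "z < 0" using dense by blast
    then show ?thesis using True by (intro SUP_upper2[of z]) auto
  qed simp
  show "(if 0 < q then top else bot :: 'a) \<le> (\<Squnion>p\<in>{..<q}. if 0 < p then top else bot)" for q :: rat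
  proof (cases "0 < q")
    case True
    then obtain z where "0 < z" "z < q" using dense by blast
    then show ?thesis using True by (intro SUP_upper2[of z]) auto
  qed simp
  show "top \<le> (\<Squnion>p::rat. if p < 0 then top else bot :: 'a)"
    by (rule SUP_upper2[of "-1"]) auto
  show "top \<le> (\<Squnion>q::rat. if 0 < q then top else bot :: 'a)"
    by (rule SUP_upper2[of 1]) auto
qed auto

lemma C_zero_closed: "C_zero \<in> C_set"
  unfolding C_zero_def by (rule IR_ext_in_C_set[OF real_values_zero])

lemma C_zero_above: "C_zero (above_gen p) = (if p < 0 then top else bot)"
  and C_zero_below: "C_zero (below_gen q) = (if 0 < q then top else bot)"
  unfolding C_zero_def by (rule IR_ext[OF real_values_zero[THEN real_values_gen_values]])+

lemma has_value_zero: "prime_filter P \<Longrightarrow> has_value P C_zero 0"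
  by (simp add: has_value_def C_zero_above C_zero_below prime_filterD)

context
  fixes f :: "IR \<Rightarrow> 'a::frame"
  assumes f: "f \<in> C_set"
begin

text \<open>Negation exchanges (r3) with (r4) and (r5) with (r6), and carries (r1) and (r2) to
  themselves.\<close>

lemma real_values_minus: "real_values (\<lambda>p. f (below_gen (- p))) (\<lambda>q. f (above_gen (- q)))"
proof (rule real_valuesI)
  note hom = C_set_hom[OF f]
  show "f (below_gen (- p)) \<sqinter> f (above_gen (- q)) = bot" if "q \<le> p" for p q
    using that hom_r1[OF hom, of "-p" "-q"] by (simp add: inf_commute)
  show "f (below_gen (- p)) \<squnion> f (above_gen (- q)) = top" if "p < q" for p q
    using that C_setD(1)[OF f, of "-q" "-p"] by (simp add: sup_commute)
  show "f (below_gen (- q)) \<le> f (below_gen (- p))" if "p \<le> q" for p q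
    using that by (intro hom_below_mono hom) auto
  show "f (above_gen (- p)) \<le> f (above_gen (- q))" if "p \<le> q" for p q
    using that by (intro hom_above_antimono hom) auto
  show "f (below_gen (- p)) \<le> (\<Squnion>q\<in>{p<..}. f (below_gen (- q)))" for p
  proof (subst hom_r4[OF hom], rule SUP_least)
    fix s assume "s \<in> {..<- p}"
    then show "f (below_gen s) \<le> (\<Squnion>q\<in>{p<..}. f (below_gen (- q)))"
      by (intro SUP_upper2[of "- s"]) auto
  qed
  show "f (above_gen (- q)) \<le> (\<Squnion>p\<in>{..<q}. f (above_gen (- p)))" for q
  proof (subst hom_r3[OF hom], rule SUP_least)
    fix s assume "s \<in> {- q<..}"
    then show "f (above_gen s) \<le> (\<Squnion>p\<in>{..<q}. f (above_gen (- p)))"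
      by (intro SUP_upper2[of "- s"]) auto
  qed
  show "top \<le> (\<Squnion>p. f (below_gen (- p)))"
    unfolding C_setD(3)[OF f, symmetric] by (rule SUP_least, rule SUP_upper2[of "- _"]) auto
  show "top \<le> (\<Squnion>q. f (above_gen (- q)))"
    unfolding C_setD(2)[OF f, symmetric] by (rule SUP_least, rule SUP_upper2[of "- _"]) auto
qed

lemma C_minus_closed: "C_minus f \<in> C_set"
  unfolding C_minus_def by (rule IR_ext_in_C_set[OF real_values_minus])

lemma C_minus_above: "C_minus f (above_gen p) = f (below_gen (- p))"
  and C_minus_below: "C_minus f (below_gen p) = f (above_gen (- p))"
  using real_values_minus[THEN real_values_gen_values] by (simp_all add: C_minus_def IR_ext)

lemma has_value_minus: "has_value P f x \<Longrightarrow> has_value P (C_minus f) (- x)"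
  by (auto simp: has_value_def C_minus_above C_minus_below of_rat_minus)

end

context
  fixes f g :: "IR \<Rightarrow> 'a::frame"
  assumes f: "f \<in> C_set" and g: "g \<in> C_set"
begin

text \<open>Stated for the join itself, since it is used for (r2), before \<open>C_add f g\<close>
  is known to take these values.\<close>

lemma sum_above_in_filter:
  assumes "prime_filter P" "has_value P f x" "has_value P g y" "of_rat p < x + y"
  shows "(\<Squnion>r. f (above_gen r) \<sqinter> g (above_gen (p - r))) \<in> P"
proof -
  obtain r where "of_rat p - y < of_rat r" "of_rat r < x"
    using of_rat_dense[of "of_rat p - y" x] assms(4) by auto
  then have "f (above_gen r) \<sqinter> g (above_gen (p - r)) \<in> P"
    using assms by (auto simp: has_value_def of_rat_diff intro!: prime_filterD(4)[OF assms(1)])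
  then show ?thesis by (rule prime_filterD(3)[OF assms(1)]) (auto intro: SUP_upper)
qed

lemma sum_below_in_filter:
  assumes "prime_filter P" "has_value P f x" "has_value P g y" "x + y < of_rat q"
  shows "(\<Squnion>s. f (below_gen s) \<sqinter> g (below_gen (q - s))) \<in> P"
proof -
  obtain s where "x < of_rat s" "of_rat s < of_rat q - y"
    using of_rat_dense[of x "of_rat q - y"] assms(4) by auto
  then have "f (below_gen s) \<sqinter> g (below_gen (q - s)) \<in> P"
    using assms by (auto simp: has_value_def of_rat_diff intro!: prime_filterD(4)[OF assms(1)])
  then show ?thesis by (rule prime_filterD(3)[OF assms(1)]) (auto intro: SUP_upper)
qed

text \<open>All relations but (r2) are inherited from \<open>f\<close> and \<open>g\<close> by
  distributivity. For (r2) the values at prime filters are used: \<open>p < q\<close> forces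
  \<open>p < x + y\<close> or \<open>x + y < q\<close>.\<close>

lemma real_values_add:
  "real_values (\<lambda>p. \<Squnion>r. f (above_gen r) \<sqinter> g (above_gen (p - r)))
    (\<lambda>q. \<Squnion>s. f (below_gen s) \<sqinter> g (below_gen (q - s)))" (is "real_values ?u ?d")
proof (rule real_valuesI)
  note homs = C_set_hom[OF f] C_set_hom[OF g]
  have u_ge: "f (above_gen r) \<sqinter> g (above_gen s) \<le> ?u (r + s)" for r s
    by (rule SUP_upper2[of r]) auto
  have d_ge: "f (below_gen r) \<sqinter> g (below_gen s) \<le> ?d (r + s)" for r s
    by (rule SUP_upper2[of r]) auto
  show "?u p \<sqinter> ?d q = bot" if "q \<le> p" for p q
    unfolding bot_unique[symmetric]
  proof (rule SUP_inf_SUP_le)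
    fix r s
    \<comment> \<open>Either \<open>s \<le> r\<close>, or \<open>q - s \<le> p - r\<close> because
      \<open>q \<le> p\<close>; (r1) annihilates the corresponding factor.\<close>
    have "f (above_gen r) \<sqinter> f (below_gen s) = bot \<or> g (above_gen (p - r)) \<sqinter> g (below_gen (q - s)) = bot"
      using that by (cases "s \<le> r") (auto intro!: hom_r1 homs)
    moreover have "f (above_gen r) \<sqinter> g (above_gen (p - r)) \<sqinter> (f (below_gen s) \<sqinter> g (below_gen (q - s))) =
      (f (above_gen r) \<sqinter> f (below_gen s)) \<sqinter> (g (above_gen (p - r)) \<sqinter> g (below_gen (q - s)))"
      by (simp add: ac_simps)
    ultimately show "f (above_gen r) \<sqinter> g (above_gen (p - r)) \<sqinter> (f (below_gen s) \<sqinter> g (below_gen (q - s))) \<le> bot"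
      by auto
  qed
  show "?u p \<squnion> ?d q = top" if "p < q" for p q
  proof (rule top_by_values[of "{f, g}"])
    fix P :: "'a set" assume P: "prime_filter P" and "\<forall>h\<in>{f, g}. \<exists>v. has_value P h v"
    then obtain x y where xy: "has_value P f x" "has_value P g y" by auto
    have "(of_rat p :: real) < of_rat q" using that by (simp add: of_rat_less)
    then consider "of_rat p < x + y" | "x + y < of_rat q" by linarith
    then show "?u p \<squnion> ?d q \<in> P"
      by cases (auto intro: prime_filterD(3)[OF P] sum_above_in_filter[OF P xy] sum_below_in_filter[OF P xy])
  qed (use f g in auto)
  show "?u q \<le> ?u p" if "p \<le> q" for p q
    using that by (intro SUP_mono' inf_mono hom_above_antimono homs) auto
  show "?d p \<le> ?d q" if "p \<le> q" for p q
    using that by (intro SUP_mono' inf_mono hom_below_mono homs) auto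
  show "?u p \<le> (\<Squnion>q\<in>{p<..}. ?u q)" for p
  proof (rule SUP_least)
    fix r
    \<comment> \<open>Expanding g(p - r,-) by (r3) raises the index from \<open>p\<close> to some
      \<open>r + s > p\<close>.\<close>
    show "f (above_gen r) \<sqinter> g (above_gen (p - r)) \<le> (\<Squnion>q\<in>{p<..}. ?u q)"
      unfolding hom_r3[OF homs(2), of "p - r"] inf_SUP
    proof (rule SUP_least)
      fix s assume "s \<in> {p - r<..}"
      then show "f (above_gen r) \<sqinter> g (above_gen s) \<le> (\<Squnion>q\<in>{p<..}. ?u q)"
        by (intro SUP_upper2[of "r + s"] u_ge) auto
    qed
  qed
  show "?d q \<le> (\<Squnion>p\<in>{..<q}. ?d p)" for q
  proof (rule SUP_least)
    fix r
    show "f (below_gen r) \<sqinter> g (below_gen (q - r)) \<le> (\<Squnion>p\<in>{..<q}. ?d p)"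
      unfolding hom_r4[OF homs(2), of "q - r"] inf_SUP
    proof (rule SUP_least)
      fix s assume "s \<in> {..<q - r}"
      then show "f (below_gen r) \<sqinter> g (below_gen s) \<le> (\<Squnion>p\<in>{..<q}. ?d p)"
        by (intro SUP_upper2[of "r + s"] d_ge) auto
    qed
  qed
  have "(\<Squnion>p. f (above_gen p)) \<sqinter> (\<Squnion>p. g (above_gen p)) \<le> (\<Squnion>p. ?u p)"
  proof (rule SUP_inf_SUP_le)
    show "f (above_gen r) \<sqinter> g (above_gen s) \<le> (\<Squnion>p. ?u p)" for r s
      using u_ge by (rule SUP_upper2[OF UNIV_I])
  qed
  then show "top \<le> (\<Squnion>p. ?u p)" using C_setD(2)[OF f] C_setD(2)[OF g] by simp
  have "(\<Squnion>p. f (below_gen p)) \<sqinter> (\<Squnion>p. g (below_gen p)) \<le> (\<Squnion>p. ?d p)"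
  proof (rule SUP_inf_SUP_le)
    show "f (below_gen r) \<sqinter> g (below_gen s) \<le> (\<Squnion>p. ?d p)" for r s
      using d_ge by (rule SUP_upper2[OF UNIV_I])
  qed
  then show "top \<le> (\<Squnion>q. ?d q)" using C_setD(3)[OF f] C_setD(3)[OF g] by simp
qed

lemma C_add_closed: "C_add f g \<in> C_set"
  unfolding C_add_def by (rule IR_ext_in_C_set[OF real_values_add])

lemma C_add_above: "C_add f g (above_gen p) = (\<Squnion>r. f (above_gen r) \<sqinter> g (above_gen (p - r)))"
  and C_add_below: "C_add f g (below_gen q) = (\<Squnion>s. f (below_gen s) \<sqinter> g (below_gen (q - s)))"
  using real_values_add[THEN real_values_gen_values] by (simp_all add: C_add_def IR_ext)

lemma has_value_add:
  assumes "prime_filter P" "has_value P f x" "has_value P g y"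
  shows "has_value P (C_add f g) (x + y)"
  using sum_above_in_filter[OF assms] sum_below_in_filter[OF assms]
  by (simp add: has_value_def C_add_above C_add_below)

lemma real_values_sup:
  "real_values (\<lambda>p. f (above_gen p) \<squnion> g (above_gen p)) (\<lambda>q. f (below_gen q) \<sqinter> g (below_gen q))"
proof (rule real_valuesI)
  note homs = C_set_hom[OF f] C_set_hom[OF g]
  show "(f (above_gen p) \<squnion> g (above_gen p)) \<sqinter> (f (below_gen q) \<sqinter> g (below_gen q)) = bot" if "q \<le> p" for p q
  proof -
    have "f (above_gen p) \<sqinter> (f (below_gen q) \<sqinter> g (below_gen q)) = bot"
      "g (above_gen p) \<sqinter> (f (below_gen q) \<sqinter> g (below_gen q)) = bot"
      using hom_r1[OF homs(1) that] hom_r1[OF homs(2) that]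
      by (metis inf.assoc inf_bot_left, metis inf.left_commute inf_bot_right)
    then show ?thesis by (simp add: inf_sup_distrib2)
  qed
  show "f (above_gen p) \<squnion> g (above_gen p) \<squnion> f (below_gen q) \<sqinter> g (below_gen q) = top" if "p < q" for p q
  proof -
    have "f (above_gen p) \<squnion> g (above_gen p) \<squnion> f (below_gen q) = top"
      "f (above_gen p) \<squnion> g (above_gen p) \<squnion> g (below_gen q) = top"
      using C_setD(1)[OF f that] C_setD(1)[OF g that]
      by (metis sup.commute sup.left_commute sup_top_right, metis sup.assoc sup_top_right)
    then show ?thesis by (simp add: sup_inf_distrib1)
  qed
  show "f (above_gen q) \<squnion> g (above_gen q) \<le> f (above_gen p) \<squnion> g (above_gen p)" if "p \<le> q" for p q
    using that by (intro sup_mono hom_above_antimono homs)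
  show "f (below_gen p) \<sqinter> g (below_gen p) \<le> f (below_gen q) \<sqinter> g (below_gen q)" if "p \<le> q" for p q
    using that by (intro inf_mono hom_below_mono homs)
  show "f (above_gen p) \<squnion> g (above_gen p) \<le> (\<Squnion>q\<in>{p<..}. f (above_gen q) \<squnion> g (above_gen q))" for p
    unfolding hom_r3[OF homs(1), of p] hom_r3[OF homs(2), of p] by (simp add: SUP_sup_distrib)
  show "f (below_gen q) \<sqinter> g (below_gen q) \<le> (\<Squnion>p\<in>{..<q}. f (below_gen p) \<sqinter> g (below_gen p))" for q
    unfolding hom_r4[OF homs(1), of q] hom_r4[OF homs(2), of q]
  proof (rule SUP_inf_SUP_le)
    \<comment> \<open>Two indices below \<open>q\<close> are merged into \<open>max i j\<close>,
      which is still below \<open>q\<close>.\<close>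
    fix i j assume "i \<in> {..<q}" "j \<in> {..<q}"
    then show "f (below_gen i) \<sqinter> g (below_gen j) \<le> (\<Squnion>p\<in>{..<q}. f (below_gen p) \<sqinter> g (below_gen p))"
      by (intro SUP_upper2[of "max i j"] inf_mono hom_below_mono homs) auto
  qed
  show "top \<le> (\<Squnion>p. f (above_gen p) \<squnion> g (above_gen p))"
    using C_setD(2)[OF f] by (simp flip: SUP_sup_distrib)
  have "(\<Squnion>p. f (below_gen p)) \<sqinter> (\<Squnion>p. g (below_gen p)) \<le> (\<Squnion>q. f (below_gen q) \<sqinter> g (below_gen q))"
  proof (rule SUP_inf_SUP_le)
    fix i j
    show "f (below_gen i) \<sqinter> g (below_gen j) \<le> (\<Squnion>p. f (below_gen p) \<sqinter> g (below_gen p))"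
      by (intro SUP_upper2[of "max i j"] inf_mono hom_below_mono homs) auto
  qed
  then show "top \<le> (\<Squnion>q. f (below_gen q) \<sqinter> g (below_gen q))"
    using C_setD(3)[OF f] C_setD(3)[OF g] by simp
qed

lemma C_sup_closed: "C_sup f g \<in> C_set"
  unfolding C_sup_def by (rule IR_ext_in_C_set[OF real_values_sup])

lemma C_sup_above: "C_sup f g (above_gen p) = f (above_gen p) \<squnion> g (above_gen p)"
  and C_sup_below: "C_sup f g (below_gen q) = f (below_gen q) \<sqinter> g (below_gen q)"
  using real_values_sup[THEN real_values_gen_values] by (simp_all add: C_sup_def IR_ext)

end

lemma C_inf_closed: "f \<in> C_set \<Longrightarrow> g \<in> C_set \<Longrightarrow> C_inf f g \<in> C_set"
  by (simp add: C_inf_def C_minus_closed C_sup_closed)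

lemma C_inf_above:
    "f \<in> C_set \<Longrightarrow> g \<in> C_set \<Longrightarrow> C_inf f g (above_gen p) = f (above_gen p) \<sqinter> g (above_gen p)"
  and C_inf_below:
    "f \<in> C_set \<Longrightarrow> g \<in> C_set \<Longrightarrow> C_inf f g (below_gen q) = f (below_gen q) \<squnion> g (below_gen q)"
  by (simp_all add: C_inf_def C_minus_closed C_sup_closed C_minus_above C_minus_below
      C_sup_above C_sup_below)

context
  fixes f :: "IR \<Rightarrow> 'a::frame" and c :: real
  assumes f: "f \<in> C_set" and c: "c > 0"
begin

lemma scale_above_in_filter:
  assumes "prime_filter P" "has_value P f x" "of_rat p < c * x"
  shows "\<Squnion>{f (above_gen r) | r. c * of_rat r > of_rat p} \<in> P"
proof -
  obtain r where "of_rat p / c < of_rat r" "of_rat r < x"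
    using of_rat_dense[of "of_rat p / c" x] assms(3) c by (auto simp: field_simps)
  then have "f (above_gen r) \<in> P" "of_rat p < c * of_rat r"
    using assms c by (auto simp: has_value_def field_simps)
  then show ?thesis by (blast intro: prime_filterD(3)[OF assms(1)] Sup_upper)
qed

lemma scale_below_in_filter:
  assumes "prime_filter P" "has_value P f x" "c * x < of_rat q"
  shows "\<Squnion>{f (below_gen s) | s. c * of_rat s < of_rat q} \<in> P"
proof -
  obtain s where "x < of_rat s" "of_rat s < of_rat q / c"
    using of_rat_dense[of x "of_rat q / c"] assms(3) c by (auto simp: field_simps)
  then have "f (below_gen s) \<in> P" "c * of_rat s < of_rat q"
    using assms c by (auto simp: has_value_def field_simps)
  then show ?thesis by (blast intro: prime_filterD(3)[OF assms(1)] Sup_upper)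
qed

text \<open>Again only (r2) goes through prime filters. Since \<open>c * of_rat r\<close> may be
  irrational, the comparisons take place in the reals, with rationals interpolated by
  density.\<close>

lemma real_values_scale_pos:
  "real_values (\<lambda>p. \<Squnion>{f (above_gen r) | r. c * of_rat r > of_rat p})
    (\<lambda>q. \<Squnion>{f (below_gen s) | s. c * of_rat s < of_rat q})" (is "real_values ?u ?d")
proof (rule real_valuesI)
  note hom = C_set_hom[OF f]
  have u_ge: "f (above_gen r) \<le> ?u p" if "c * of_rat r > of_rat p" for r p
    using that by (blast intro: Sup_upper)
  have d_ge: "f (below_gen s) \<le> ?d q" if "c * of_rat s < of_rat q" for s q
    using that by (blast intro: Sup_upper)
  show "?u p \<sqinter> ?d q = bot" if "q \<le> p" for p q
    unfolding bot_unique[symmetric] setcompr_eq_image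
  proof (rule SUP_inf_SUP_le)
    fix r s assume rs: "r \<in> {r. c * of_rat r > of_rat p}" "s \<in> {s. c * of_rat s < of_rat q}"
    have "(of_rat q :: real) \<le> of_rat p" using that by (simp add: of_rat_less_eq)
    then have "c * of_rat s < c * of_rat r" using rs by simp
    then have "s \<le> r" using c by (simp add: of_rat_less)
    then show "f (above_gen r) \<sqinter> f (below_gen s) \<le> bot" by (simp add: hom_r1[OF hom])
  qed
  show "?u p \<squnion> ?d q = top" if "p < q" for p q
  proof (rule top_by_values[of "{f}"])
    fix P :: "'a set" assume P: "prime_filter P" and "\<forall>h\<in>{f}. \<exists>v. has_value P h v"
    then obtain x where x: "has_value P f x" by auto
    have "(of_rat p :: real) < of_rat q" using that by (simp add: of_rat_less)
    then consider "of_rat p < c * x" | "c * x < of_rat q" by linarith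
    then show "?u p \<squnion> ?d q \<in> P"
      using scale_above_in_filter[OF P x, of p] scale_below_in_filter[OF P x, of q]
      by cases (blast intro: prime_filterD(3)[OF P] sup_ge1 sup_ge2)+
  qed (use f in auto)
  show "?u q \<le> ?u p" if "p \<le> q" for p q
  proof (rule Sup_subset_mono)
    have "(of_rat p :: real) \<le> of_rat q" using that by (simp add: of_rat_less_eq)
    then show "{f (above_gen r) | r. c * of_rat r > of_rat q} \<subseteq> {f (above_gen r) | r. c * of_rat r > of_rat p}"
      by fastforce
  qed
  show "?d p \<le> ?d q" if "p \<le> q" for p q
  proof (rule Sup_subset_mono)
    have "(of_rat p :: real) \<le> of_rat q" using that by (simp add: of_rat_less_eq)
    then show "{f (below_gen r) | r. c * of_rat r < of_rat p} \<subseteq> {f (below_gen r) | r. c * of_rat r < of_rat q}"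
      by fastforce
  qed
  show "?u p \<le> (\<Squnion>q\<in>{p<..}. ?u q)" for p
  proof (rule Sup_least, clarify)
    fix r assume "of_rat p < c * of_rat r"
    then obtain q where "of_rat p < (of_rat q :: real)" "of_rat q < c * of_rat r"
      using of_rat_dense by blast
    then show "f (above_gen r) \<le> (\<Squnion>q\<in>{p<..}. ?u q)"
      by (intro SUP_upper2[of q] u_ge) (auto simp: of_rat_less)
  qed
  show "?d q \<le> (\<Squnion>p\<in>{..<q}. ?d p)" for q
  proof (rule Sup_least, clarify)
    fix r assume "c * of_rat r < of_rat q"
    then obtain p where "(of_rat p :: real) < of_rat q" "c * of_rat r < of_rat p"
      using of_rat_dense by blast
    then show "f (below_gen r) \<le> (\<Squnion>p\<in>{..<q}. ?d p)"
      by (intro SUP_upper2[of p] d_ge) (auto simp: of_rat_less)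
  qed
  show "top \<le> (\<Squnion>p. ?u p)"
    unfolding C_setD(2)[OF f, symmetric]
  proof (rule SUP_least)
    fix r
    obtain p where "of_rat p < c * of_rat r"
      using of_rat_dense[of "c * of_rat r - 1" "c * of_rat r"] by auto
    then show "f (above_gen r) \<le> (\<Squnion>p. ?u p)" by (intro SUP_upper2[of p] u_ge) auto
  qed
  show "top \<le> (\<Squnion>q. ?d q)"
    unfolding C_setD(3)[OF f, symmetric]
  proof (rule SUP_least)
    fix r
    obtain q where "c * of_rat r < of_rat q"
      using of_rat_dense[of "c * of_rat r" "c * of_rat r + 1"] by auto
    then show "f (below_gen r) \<le> (\<Squnion>q. ?d q)" by (intro SUP_upper2[of q] d_ge) auto
  qed
qed

lemma C_scale_pos_closed: "C_scale_pos c f \<in> C_set"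
  unfolding C_scale_pos_def by (rule IR_ext_in_C_set[OF real_values_scale_pos])

lemma C_scale_pos_above:
    "C_scale_pos c f (above_gen p) = \<Squnion>{f (above_gen r) | r. c * of_rat r > of_rat p}"
  and C_scale_pos_below:
    "C_scale_pos c f (below_gen q) = \<Squnion>{f (below_gen s) | s. c * of_rat s < of_rat q}"
  using real_values_scale_pos[THEN real_values_gen_values] by (simp_all add: C_scale_pos_def IR_ext)

lemma has_value_scale_pos:
  assumes "prime_filter P" "has_value P f x"
  shows "has_value P (C_scale_pos c f) (c * x)"
  using scale_above_in_filter[OF assms] scale_below_in_filter[OF assms]
  by (simp add: has_value_def C_scale_pos_above C_scale_pos_below)

end

lemma C_scale_closed: "f \<in> C_set \<Longrightarrow> C_scale c f \<in> C_set"
  by (simp add: C_scale_def C_scale_pos_closed C_zero_closed C_minus_closed)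

lemma has_value_scale:
  assumes "f \<in> C_set" "prime_filter P" "has_value P f x"
  shows "has_value P (C_scale c f) (c * x)"
proof (cases "c < 0")
  case True
  then have "has_value P (C_minus (C_scale_pos (- c) f)) (- (- c * x))"
    using assms by (intro has_value_minus has_value_scale_pos C_scale_pos_closed) auto
  then show ?thesis using True by (simp add: C_scale_def)
qed (use assms in \<open>auto simp: C_scale_def has_value_scale_pos has_value_zero\<close>)


section \<open>The laws of the reals transferred to C(L)\<close>

section \<open>The Riesz space of continuous functions\<close>

lemma C_space_simps [simp]:
  "carrier C_space = C_set" "leq C_space = IC_le" "zero C_space = C_zero"
  "add C_space = C_add" "scale C_space = C_scale"
  by (simp_all add: C_space_def)

lemma IC_le_refl: "IC_le f f"
  by (simp add: IC_le_def)

lemma IC_le_trans: "IC_le f g \<Longrightarrow> IC_le g h \<Longrightarrow> IC_le f h"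
  unfolding IC_le_def by (meson order.trans)

lemma is_sup_C_sup: "f \<in> C_set \<Longrightarrow> g \<in> C_set \<Longrightarrow> is_sup C_space {f, g} (C_sup f g)"
  by (auto simp: is_sup_def IC_le_def C_sup_closed C_sup_above C_sup_below)

lemma is_inf_C_inf: "f \<in> C_set \<Longrightarrow> g \<in> C_set \<Longrightarrow> is_inf C_space {f, g} (C_inf f g)"
  by (auto simp: is_inf_def IC_le_def C_inf_closed C_inf_above C_inf_below)

lemmas has_value_ops = has_value_zero has_value_minus has_value_add has_value_scale
lemmas C_closed = C_zero_closed C_minus_closed C_add_closed C_scale_closed

text \<open>The identities follow one pattern: both sides are evaluated at a prime filter where all
  variables have values, and the results agree by the corresponding law of the reals. For
  monotonicity of the operations, \<open>has_value_le\<close> first turns the assumed inequality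
  into one between values.\<close>

theorem riesz_space_C_space: "riesz_space (C_space :: (IR \<Rightarrow> 'a::frame) ordered_space)"
proof (unfold_locales, unfold C_space_simps)
  fix f g h :: "IR \<Rightarrow> 'a" and b c :: real
  assume f: "f \<in> C_set"
  show "C_scale c f \<in> C_set" by (rule C_scale_closed[OF f])
  have fin: "finite {f, g, h}" by simp
  {
    assume g: "g \<in> C_set"
    show "C_add f g \<in> C_set" by (rule C_add_closed[OF f g])
    show "\<exists>s. is_sup C_space {f, g} s" "\<exists>s. is_inf C_space {f, g} s"
      using is_sup_C_sup[OF f g] is_inf_C_inf[OF f g] by blast+
    show "C_add f g = C_add g f"
    proof (rule C_eq_by_values[of "{f, g}"])
      fix P :: "'a set" assume P: "prime_filter P" "\<forall>k\<in>{f, g}. \<exists>v. has_value P k v"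
      then obtain x y where "has_value P f x" "has_value P g y" by auto
      then have "has_value P (C_add f g) (x + y)" "has_value P (C_add g f) (y + x)"
        using P(1) f g by - (intro has_value_ops C_closed; assumption)+
      then show "\<exists>x. has_value P (C_add f g) x \<and> has_value P (C_add g f) x"
        by (auto simp: add.commute)
    qed (use f g in \<open>auto intro: C_closed\<close>)
    show "C_scale c (C_add f g) = C_add (C_scale c f) (C_scale c g)"
    proof (rule C_eq_by_values[of "{f, g}"])
      fix P :: "'a set" assume P: "prime_filter P" "\<forall>k\<in>{f, g}. \<exists>v. has_value P k v"
      then obtain x y where "has_value P f x" "has_value P g y" by auto
      then have "has_value P (C_scale c (C_add f g)) (c * (x + y))"
        "has_value P (C_add (C_scale c f) (C_scale c g)) (c * x + c * y)"
        using P(1) f g by - (intro has_value_ops C_closed; assumption)+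
      then show "\<exists>x. has_value P (C_scale c (C_add f g)) x \<and>
          has_value P (C_add (C_scale c f) (C_scale c g)) x"
        by (auto simp: distrib_left)
    qed (use f g in \<open>auto intro: C_closed\<close>)
    show "f = g" if "IC_le f g" "IC_le g f"
      using that f g by (intro IC_le_antisym) (auto simp: C_set_hom)
    show "IC_le (C_scale c f) (C_scale c g)" if le: "IC_le f g" and c: "0 \<le> c"
    proof (rule IC_le_by_values[of "{f, g}"])
      fix P :: "'a set" assume P: "prime_filter P" "\<forall>k\<in>{f, g}. \<exists>v. has_value P k v"
      then obtain x y where xy: "has_value P f x" "has_value P g y" by auto
      moreover have "x \<le> y" by (rule has_value_le[OF C_set_hom[OF g] P(1) xy le])
      ultimately show "\<exists>x y. has_value P (C_scale c f) x \<and> has_value P (C_scale c g) y \<and> x \<le> y"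
        using has_value_scale P(1) f g c mult_left_mono by meson
    qed (use f g in \<open>auto intro: C_closed\<close>)
    assume h: "h \<in> C_set"
    show "C_add (C_add f g) h = C_add f (C_add g h)"
    proof (rule C_eq_by_values[of "{f, g, h}"])
      fix P :: "'a set" assume P: "prime_filter P" "\<forall>k\<in>{f, g, h}. \<exists>v. has_value P k v"
      then obtain x y z where "has_value P f x" "has_value P g y" "has_value P h z" by auto
      then have "has_value P (C_add (C_add f g) h) (x + y + z)"
        "has_value P (C_add f (C_add g h)) (x + (y + z))"
        using P(1) f g h by - (intro has_value_ops C_closed; assumption)+
      then show "\<exists>x. has_value P (C_add (C_add f g) h) x \<and> has_value P (C_add f (C_add g h)) x"
        by (auto simp: add.assoc)
    qed (use f g h in \<open>auto intro: C_closed\<close>)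
    show "IC_le f h" if "IC_le f g" "IC_le g h" using that by (rule IC_le_trans)
    show "IC_le (C_add f h) (C_add g h)" if le: "IC_le f g"
    proof (rule IC_le_by_values[of "{f, g, h}"])
      fix P :: "'a set" assume P: "prime_filter P" "\<forall>k\<in>{f, g, h}. \<exists>v. has_value P k v"
      then obtain x y z where xy: "has_value P f x" "has_value P g y" and z: "has_value P h z"
        by auto
      moreover have "x \<le> y" by (rule has_value_le[OF C_set_hom[OF g] P(1) xy le])
      ultimately show "\<exists>x y. has_value P (C_add f h) x \<and> has_value P (C_add g h) y \<and> x \<le> y"
        using has_value_add P(1) f g h add_right_mono by meson
    qed (use f g h in \<open>auto intro: C_closed\<close>)
  }
  show "C_add f C_zero = f"
  proof (rule C_eq_by_values[of "{f}"])
    fix P :: "'a set" assume P: "prime_filter P" "\<forall>k\<in>{f}. \<exists>v. has_value P k v"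
    then obtain x where "has_value P f x" by auto
    moreover from this have "has_value P (C_add f C_zero) (x + 0)"
      using P(1) f by - (intro has_value_ops C_closed; assumption)
    ultimately show "\<exists>x. has_value P (C_add f C_zero) x \<and> has_value P f x" by auto
  qed (use f in \<open>auto intro: C_closed\<close>)
  have "C_add f (C_minus f) = C_zero"
  proof (rule C_eq_by_values[of "{f}"])
    fix P :: "'a set" assume P: "prime_filter P" "\<forall>k\<in>{f}. \<exists>v. has_value P k v"
    then obtain x where "has_value P f x" by auto
    then have "has_value P (C_add f (C_minus f)) (x + - x)"
      using P(1) f by - (intro has_value_ops C_closed; assumption)
    then show "\<exists>x. has_value P (C_add f (C_minus f)) x \<and> has_value P C_zero x"
      using has_value_zero[OF P(1)] by auto
  qed (use f in \<open>auto intro: C_closed\<close>)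
  then show "\<exists>k\<in>C_set. C_add f k = C_zero" using C_minus_closed[OF f] by blast
  show "C_scale (b + c) f = C_add (C_scale b f) (C_scale c f)"
  proof (rule C_eq_by_values[of "{f}"])
    fix P :: "'a set" assume P: "prime_filter P" "\<forall>k\<in>{f}. \<exists>v. has_value P k v"
    then obtain x where "has_value P f x" by auto
    then have "has_value P (C_scale (b + c) f) ((b + c) * x)"
      "has_value P (C_add (C_scale b f) (C_scale c f)) (b * x + c * x)"
      using P(1) f by - (intro has_value_ops C_closed; assumption)+
    then show "\<exists>x. has_value P (C_scale (b + c) f) x \<and> has_value P (C_add (C_scale b f) (C_scale c f)) x"
      by (auto simp: distrib_right)
  qed (use f in \<open>auto intro: C_closed\<close>)
  show "C_scale b (C_scale c f) = C_scale (b * c) f"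
  proof (rule C_eq_by_values[of "{f}"])
    fix P :: "'a set" assume P: "prime_filter P" "\<forall>k\<in>{f}. \<exists>v. has_value P k v"
    then obtain x where "has_value P f x" by auto
    then have "has_value P (C_scale b (C_scale c f)) (b * (c * x))"
      "has_value P (C_scale (b * c) f) (b * c * x)"
      using P(1) f by - (intro has_value_ops C_closed; assumption)+
    then show "\<exists>x. has_value P (C_scale b (C_scale c f)) x \<and> has_value P (C_scale (b * c) f) x"
      by (auto simp: mult.assoc)
  qed (use f in \<open>auto intro: C_closed\<close>)
  show "C_scale 1 f = f"
  proof (rule C_eq_by_values[of "{f}"])
    fix P :: "'a set" assume P: "prime_filter P" "\<forall>k\<in>{f}. \<exists>v. has_value P k v"
    then obtain x where "has_value P f x" by auto
    moreover from this have "has_value P (C_scale 1 f) (1 * x)"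
      using P(1) f by - (intro has_value_ops C_closed; assumption)
    ultimately show "\<exists>x. has_value P (C_scale 1 f) x \<and> has_value P f x" by auto
  qed (use f in \<open>auto intro: C_closed\<close>)
qed (auto intro: C_zero_closed IC_le_refl)


section \<open>Real functions from descending scales\<close>

section \<open>Scales and suprema\<close>

lemma rather_below_imp_le: "rather_below b a \<Longrightarrow> b \<le> (a :: 'a::frame)"
  unfolding rather_below_def by (rule le_of_inf_sup_top) (auto simp: inf_pcompl)

text \<open>\<open>e q\<close> approximates the region where the function exceeds \<open>q\<close>,
  and joining over \<open>q > p\<close> enforces (r3). This serves both for suprema over the
  Booleanization and for Urysohn functions.\<close>

lemma real_values_of_scale:
  fixes e :: "rat \<Rightarrow> 'a::frame"
  assumes e: "\<And>p q. p < q \<Longrightarrow> rather_below (e q) (e p)"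
    and "(\<Squnion>q. e q) = top" "(\<Squnion>q. pcompl (e q)) = top"
  shows "real_values (\<lambda>p. \<Squnion>q\<in>{p<..}. e q) (\<lambda>q. \<Squnion>s\<in>{..<q}. pcompl (e s))"
    (is "real_values ?u ?d")
proof (rule real_valuesI)
  show "?u p \<sqinter> ?d q = bot" if "q \<le> p" for p q
    unfolding bot_unique[symmetric]
  proof (rule SUP_inf_SUP_le)
    fix r s assume "r \<in> {p<..}" "s \<in> {..<q}"
    then have "e r \<le> e s" using that by (intro rather_below_imp_le e) auto
    then have "e r \<sqinter> pcompl (e s) \<le> e s \<sqinter> pcompl (e s)" by (rule inf_mono) simp
    then show "e r \<sqinter> pcompl (e s) \<le> bot" by (simp add: inf_pcompl)
  qed
  show "?u p \<squnion> ?d q = top" if "p < q" for p q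
  proof -
    \<comment> \<open>Two interpolated rationals are used: \<open>e x\<close> enters
      \<open>?u p\<close>, the pseudocomplement of \<open>e y\<close> enters \<open>?d q\<close>,
      and \<open>e y\<close> is rather below \<open>e x\<close>.\<close>
    obtain x where x: "p < x" "x < q" using \<open>p < q\<close> dense by blast
    obtain y where y: "x < y" "y < q" using x dense by blast
    have "top = pcompl (e y) \<squnion> e x" using e[OF y(1)] by (simp add: rather_below_def)
    also have "\<dots> \<le> ?u p \<squnion> ?d q"
      using x y by (intro sup_least le_supI1[of _ "?u p"] le_supI2[of _ "?d q"] SUP_upper) auto
    finally show ?thesis by (simp add: top_unique)
  qed
  show "?u q \<le> ?u p" if "p \<le> q" for p q using that by (intro SUP_subset_mono) auto
  show "?d p \<le> ?d q" if "p \<le> q" for p q using that by (intro SUP_subset_mono) auto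
  show "?u p \<le> (\<Squnion>q\<in>{p<..}. ?u q)" for p
  proof (rule SUP_least)
    fix r assume "r \<in> {p<..}"
    then obtain q where "p < q" "q < r" using dense by auto
    then show "e r \<le> (\<Squnion>q\<in>{p<..}. ?u q)" by (intro SUP_upper2[of q] SUP_upper) auto
  qed
  show "?d q \<le> (\<Squnion>p\<in>{..<q}. ?d p)" for q
  proof (rule SUP_least)
    fix s assume "s \<in> {..<q}"
    then obtain p where "s < p" "p < q" using dense by auto
    then show "pcompl (e s) \<le> (\<Squnion>p\<in>{..<q}. ?d p)"
      by (intro SUP_upper2[of p] SUP_upper) auto
  qed
  have "e r \<le> (\<Squnion>p. ?u p)" for r by (intro SUP_upper2[of "r - 1"] SUP_upper) auto
  then show "top \<le> (\<Squnion>p. ?u p)" unfolding assms(2)[symmetric] by (rule SUP_least)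
  have "pcompl (e s) \<le> (\<Squnion>q. ?d q)" for s by (intro SUP_upper2[of "s + 1"] SUP_upper) auto
  then show "top \<le> (\<Squnion>q. ?d q)" unfolding assms(3)[symmetric] by (rule SUP_least)
qed

section \<open>Dedekind and lateral completeness over a Boolean frame\<close>

lemma pcompl_bot [simp]: "pcompl bot = (top :: 'a::frame)"
  by (simp add: le_pcompl_iff flip: top_unique)

text \<open>\<open>a \<squnion> pcompl a\<close> is dense in the underlying frame, so
  \<open>y\<close> complements \<open>x\<close> in the Booleanization. Being disjoint from
  \<open>x\<close>, it lies below \<open>pcompl x\<close>, the pseudocomplement formed in the
  Booleanization.\<close>

lemma sup_pcompl_booln: "x \<squnion> pcompl x = (top :: 'a::frame booln)"
proof -
  define a where "a = Rep_booln x"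
  define y where "y = Abs_booln (pcompl a)"
  have y: "Rep_booln y = pcompl a" by (simp add: y_def Abs_booln_inverse)
  have "pcompl (a \<squnion> pcompl a) \<le> pcompl a \<sqinter> pcompl (pcompl a)"
    by (intro inf_greatest pcompl_antimono) auto
  then have "pcompl (a \<squnion> pcompl a) = bot" by (simp add: inf_pcompl bot_unique)
  then have "x \<squnion> y = top"
    unfolding Rep_booln_inject[symmetric] by (simp add: sup_booln.rep_eq top_booln.rep_eq y flip: a_def)
  moreover have "x \<sqinter> y = bot"
    unfolding Rep_booln_inject[symmetric]
    by (simp add: inf_booln.rep_eq bot_booln.rep_eq y inf_pcompl flip: a_def)
  then have "x \<squnion> y \<le> x \<squnion> pcompl x" by (intro sup_mono) (auto simp: le_pcompl_iff)
  ultimately show ?thesis by (simp add: top_unique)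
qed

text \<open>In a Boolean frame \<le> coincides with rather below, so the pointwise joins
  \<open>S\<close> form a scale. (r5) is inherited from any member of \<open>A\<close>, and
  \<open>bounded\<close> supplies (r6).\<close>

lemma C_booln_sup_exists:
  fixes A :: "(IR \<Rightarrow> 'a::frame booln) set"
  assumes A: "A \<subseteq> C_set" "A \<noteq> {}"
    and bounded: "(\<Squnion>p. pcompl (\<Squnion>f\<in>A. f (above_gen p))) = top"
  shows "\<exists>s. is_sup C_space A s"
proof -
  define S where "S p = (\<Squnion>f\<in>A. f (above_gen p))" for p
  define s where "s = IR_ext (\<lambda>p. \<Squnion>q\<in>{p<..}. S q) (\<lambda>q. \<Squnion>p\<in>{..<q}. pcompl (S p))"
  have hom: "frame_hom f" if "f \<in> A" for f using that A C_set_hom by blast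
  have "rather_below (S q) (S p)" if "p < q" for p q
  proof -
    have "S q \<le> S p"
      unfolding S_def using that by (intro SUP_subset_mono hom_above_antimono hom) auto
    then have "pcompl (S q) \<squnion> S q \<le> pcompl (S q) \<squnion> S p" by (intro sup_mono) auto
    then show ?thesis
      using sup_pcompl_booln[of "S q"] by (simp add: rather_below_def sup_commute top_unique)
  qed
  moreover have "(\<Squnion>p. S p) = top"
  proof -
    obtain f where f: "f \<in> A" using A by blast
    have "top = (\<Squnion>p. f (above_gen p))" using f A C_setD(2)[of f] by auto
    also have "\<dots> \<le> (\<Squnion>p. S p)" unfolding S_def using f by (intro SUP_mono') (auto intro: SUP_upper)
    finally show ?thesis by (simp add: top_unique)
  qed
  moreover have "(\<Squnion>p. pcompl (S p)) = top" using bounded by (simp add: S_def)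
  ultimately have real: "real_values (\<lambda>p. \<Squnion>q\<in>{p<..}. S q) (\<lambda>q. \<Squnion>p\<in>{..<q}. pcompl (S p))"
    by (rule real_values_of_scale)
  have s: "s \<in> C_set" unfolding s_def by (rule IR_ext_in_C_set[OF real])
  have s_above: "s (above_gen p) = (\<Squnion>q\<in>{p<..}. S q)" for p
    unfolding s_def by (rule IR_ext_above[OF real[THEN real_values_gen_values]])
  have "is_sup C_space A s"
    unfolding is_sup_def C_space_simps
  proof (intro conjI ballI impI s)
    fix f assume f: "f \<in> A"
    have "f (above_gen p) \<le> s (above_gen p)" for p
      unfolding s_above hom_r3[OF hom[OF f], of p] S_def using f by (intro SUP_mono') (rule SUP_upper)
    then show "IC_le f s" using f A s by (subst IC_le_C_set_iff) (auto simp: C_set_hom)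
  next
    fix t assume t: "t \<in> C_set" and "\<forall>f\<in>A. IC_le f t"
    then have S: "S q \<le> t (above_gen q)" for q by (auto simp: S_def IC_le_def intro!: SUP_least)
    have "s (above_gen p) \<le> t (above_gen p)" for p
      unfolding s_above
    proof (rule SUP_least)
      fix q assume "q \<in> {p<..}"
      then have "t (above_gen q) \<le> t (above_gen p)" by (intro hom_above_antimono C_set_hom[OF t]) simp
      with S show "S q \<le> t (above_gen p)" by (rule order.trans)
    qed
    then show "IC_le s t" using s t by (subst IC_le_C_set_iff) (auto simp: C_set_hom)
  qed
  then show ?thesis by blast
qed

text \<open>h(-,p) is disjoint from h(p,-), hence from every f(p,-); (r6) for the upper bound
  \<open>h\<close> then gives the finiteness condition.\<close>

lemma dedekind_complete_C_booln:
  "dedekind_complete (C_space :: (IR \<Rightarrow> 'a::frame booln) ordered_space)"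
  unfolding dedekind_complete_def C_space_simps
proof (intro allI impI, elim conjE bexE)
  fix A :: "(IR \<Rightarrow> 'a booln) set" and h
  assume A: "A \<subseteq> C_set" "A \<noteq> {}" and h: "h \<in> C_set" "\<forall>f\<in>A. IC_le f h"
  have "h (below_gen p) \<le> pcompl (\<Squnion>f\<in>A. f (above_gen p))" for p
  proof -
    have "(\<Squnion>f\<in>A. f (above_gen p)) \<sqinter> h (below_gen p) \<le> h (above_gen p) \<sqinter> h (below_gen p)"
      using h by (intro inf_mono SUP_least) (auto simp: IC_le_def)
    then show ?thesis
      using hom_r1[OF C_set_hom[OF h(1)], of p p] by (simp add: le_pcompl_iff bot_unique)
  qed
  then have "(\<Squnion>p. h (below_gen p)) \<le> (\<Squnion>p. pcompl (\<Squnion>f\<in>A. f (above_gen p)))"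
    by (rule SUP_mono')
  then show "\<exists>s. is_sup C_space A s"
    using C_setD(3)[OF h(1)] by (intro C_booln_sup_exists A) (simp add: top_unique)
qed

text \<open>It suffices to cover \<open>S 0\<close> and its complement. The complement is the term
  at \<open>p = 0\<close>; on f(0,-) the other members contribute nothing at levels \<ge> 0, so
  finiteness there is (r6) for \<open>f\<close>.\<close>

lemma laterally_complete_C_booln:
  "laterally_complete (C_space :: (IR \<Rightarrow> 'a::frame booln) ordered_space)"
  unfolding laterally_complete_def C_space_simps
proof (intro allI impI, elim conjE)
  fix A :: "(IR \<Rightarrow> 'a booln) set"
  assume A: "A \<subseteq> C_set" "A \<noteq> {}"
    and disj: "\<forall>f\<in>A. \<forall>g\<in>A. f \<noteq> g \<longrightarrow> is_inf C_space {f, g} C_zero"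
  define S where "S p = (\<Squnion>f\<in>A. f (above_gen p))" for p
  have hom: "frame_hom f" if "f \<in> A" for f using that A C_set_hom by blast
  have disjoint: "f (above_gen 0) \<sqinter> g (above_gen 0) = bot" if "f \<in> A" "g \<in> A" "f \<noteq> g" for f g
  proof -
    have fg: "f \<in> C_set" "g \<in> C_set" using that A by auto
    have "IC_le (C_inf f g) C_zero"
      using disj that is_inf_C_inf[OF fg] by (auto simp: is_inf_def)
    then have "C_inf f g (above_gen 0) \<le> C_zero (above_gen 0)" by (simp add: IC_le_def)
    then show ?thesis using fg by (simp add: C_inf_above C_zero_above bot_unique)
  qed
  have 1: "f (above_gen 0) \<le> (\<Squnion>p. pcompl (S p))" if f: "f \<in> A" for f
  proof -
    have "f (above_gen 0) = f (above_gen 0) \<sqinter> (\<Squnion>q. f (below_gen q))"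
      using f A C_setD(3)[of f] by auto
    also have "\<dots> = (\<Squnion>q. f (above_gen 0) \<sqinter> f (below_gen q))" by (rule inf_SUP)
    also have "\<dots> \<le> (\<Squnion>p. pcompl (S p))"
    proof (rule SUP_least)
      fix q :: rat
      \<comment> \<open>\<open>m \<ge> 0\<close> disposes of the members other than
        \<open>f\<close>, and \<open>m \<ge> q\<close> of \<open>f\<close> itself on f(-,q).\<close>
      define m where "m = max q 0"
      have "g (above_gen m) \<sqinter> (f (above_gen 0) \<sqinter> f (below_gen q)) \<le> bot" if g: "g \<in> A" for g
      proof (cases "g = f")
        case True
        have "g (above_gen m) \<sqinter> (f (above_gen 0) \<sqinter> f (below_gen q)) \<le> f (above_gen m) \<sqinter> f (below_gen q)"
          unfolding True by (simp add: le_infI2)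
        also have "\<dots> = bot" using hom[OF f] by (intro hom_r1) (auto simp: m_def)
        finally show ?thesis .
      next
        case False
        have "g (above_gen m) \<le> g (above_gen 0)"
          by (intro hom_above_antimono hom g) (simp add: m_def)
        then have "g (above_gen m) \<sqinter> (f (above_gen 0) \<sqinter> f (below_gen q)) \<le> g (above_gen 0) \<sqinter> f (above_gen 0)"
          by (intro inf_mono) auto
        then show ?thesis using disjoint[OF g f False] by simp
      qed
      then have "S m \<sqinter> (f (above_gen 0) \<sqinter> f (below_gen q)) = bot"
        unfolding S_def SUP_inf by (intro bot_unique[THEN iffD1] SUP_least)
      then show "f (above_gen 0) \<sqinter> f (below_gen q) \<le> (\<Squnion>p. pcompl (S p))"
        by (intro SUP_upper2[of m]) (auto simp: le_pcompl_iff)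
    qed
    finally show ?thesis .
  qed
  have "S 0 \<squnion> pcompl (S 0) \<le> (\<Squnion>p. pcompl (S p))"
  proof (rule sup_least)
    show "S 0 \<le> (\<Squnion>p. pcompl (S p))" unfolding S_def[of 0] using 1 by (rule SUP_least)
  qed (auto intro: SUP_upper)
  then show "\<exists>s. is_sup C_space A s"
    by (intro C_booln_sup_exists A) (simp add: sup_pcompl_booln top_unique S_def)
qed


section \<open>Riesz space structures carried along an order isomorphism\<close>

section \<open>Transport of Riesz spaces\<close>

text \<open>Later \<open>V\<close> is C(B(L)), \<open>W\<close> is H_nf(L), \<open>G\<close> is
  \<open>Gamma\<close> and \<open>D\<close> is \<open>Delta\<close>. The axioms for \<open>W\<close>
  reduce to those for \<open>V\<close> once \<open>D\<close> and \<open>G\<close> cancel.\<close>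

locale riesz_transport = V: riesz_space V
  for V :: "('v, 'm) ordered_space_scheme" +
  fixes W :: "('w, 'n) ordered_space_scheme" and G :: "'w \<Rightarrow> 'v" and D :: "'v \<Rightarrow> 'w"
  assumes G_closed: "x \<in> carrier W \<Longrightarrow> G x \<in> carrier V"
    and D_closed: "y \<in> carrier V \<Longrightarrow> D y \<in> carrier W"
    and D_G: "x \<in> carrier W \<Longrightarrow> D (G x) = x"
    and G_D: "y \<in> carrier V \<Longrightarrow> G (D y) = y"
    and leq_iff: "x \<in> carrier W \<Longrightarrow> x' \<in> carrier W \<Longrightarrow> leq W x x' \<longleftrightarrow> leq V (G x) (G x')"
    and zero_eq: "zero W = D (zero V)"
    and add_eq: "add W x x' = D (add V (G x) (G x'))"
    and scale_eq: "scale W c x = D (scale V c (G x))"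
begin

lemma is_sup_D:
  assumes A: "A \<subseteq> carrier W" and s: "is_sup V (G ` A) s"
  shows "is_sup W A (D s)"
  using s A by (auto simp: is_sup_def leq_iff D_closed G_D G_closed subset_iff)

lemma is_inf_D:
  assumes A: "A \<subseteq> carrier W" and s: "is_inf V (G ` A) s"
  shows "is_inf W A (D s)"
  using s A by (auto simp: is_inf_def leq_iff D_closed G_D G_closed subset_iff)

text \<open>The converse direction carries pairwise disjointness from \<open>W\<close> to
  \<open>V\<close> in the proof of lateral completeness.\<close>

lemma is_inf_G:
  assumes A: "A \<subseteq> carrier W" and s: "is_inf W A s"
  shows "is_inf V (G ` A) (G s)"
proof -
  have "leq V t (G s)" if "t \<in> carrier V" "\<forall>a\<in>A. leq V t (G a)" for t
  proof -
    have "leq W (D t) s"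
    proof -
      have "D t \<in> carrier W" "\<forall>a\<in>A. leq W (D t) a"
        using that A by (auto simp: leq_iff D_closed G_D subset_iff)
      then show ?thesis using s unfolding is_inf_def by blast
    qed
    moreover have "s \<in> carrier W" using s by (simp add: is_inf_def)
    ultimately show ?thesis using that(1) leq_iff[of "D t" s] by (simp add: D_closed G_D)
  qed
  then show ?thesis
    using s A by (auto simp: is_inf_def leq_iff G_closed subset_iff)
qed

lemma riesz_space_W: "riesz_space W"
proof (unfold_locales)
  fix x y z b c assume x: "x \<in> carrier W"
  note simps = G_closed D_closed G_D D_G leq_iff zero_eq add_eq scale_eq
    V.zero_closed V.add_closed V.scale_closed
  show "scale W c x \<in> carrier W" "add W x (zero W) = x"
    "scale W (b + c) x = add W (scale W b x) (scale W c x)"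
    "scale W b (scale W c x) = scale W (b * c) x" "scale W 1 x = x" "leq W x x"
    using x by (simp_all add: simps V.add_zero V.scale_add_left V.scale_scale V.scale_one V.leq_refl)
  obtain k where "k \<in> carrier V" "add V (G x) k = zero V" using V.add_inverse x G_closed by blast
  then show "\<exists>y\<in>carrier W. add W x y = zero W" by (intro bexI[of _ "D k"]) (simp_all add: simps)
  assume y: "y \<in> carrier W"
  show "add W x y \<in> carrier W" "scale W c (add W x y) = add W (scale W c x) (scale W c y)"
    using x y by (simp_all add: simps V.scale_add_right)
  show "add W x y = add W y x" using x y V.add_commute[of "G x" "G y"] by (simp add: simps)
  show "\<exists>s. is_sup W {x, y} s" "\<exists>s. is_inf W {x, y} s"
    using V.sup_exists[of "G x" "G y"] V.inf_exists[of "G x" "G y"] is_sup_D[of "{x, y}"]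
      is_inf_D[of "{x, y}"] x y by (auto simp: G_closed)
  show "x = y" if "leq W x y" "leq W y x"
    using that x y by (metis D_G G_closed V.leq_antisym leq_iff)
  show "leq W (scale W c x) (scale W c y)" if "leq W x y" "0 \<le> c"
    using that x y by (simp add: simps V.leq_scale)
  assume z: "z \<in> carrier W"
  show "add W (add W x y) z = add W x (add W y z)"
    using x y z by (simp add: simps V.add_assoc)
  show "leq W x z" if "leq W x y" "leq W y z"
    using that x y z V.leq_trans[of "G x" "G y" "G z"] by (simp add: simps)
  show "leq W (add W x z) (add W y z)" if "leq W x y"
    using that x y z by (simp add: simps V.leq_add)
qed (simp add: zero_eq D_closed V.zero_closed)

lemma dedekind_complete_W:
  assumes V: "dedekind_complete V"
  shows "dedekind_complete W"
  unfolding dedekind_complete_def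
proof (intro allI impI, elim conjE bexE)
  fix A u assume A: "A \<subseteq> carrier W" "A \<noteq> {}" and u: "u \<in> carrier W" "\<forall>a\<in>A. leq W a u"
  have "\<exists>s. is_sup V (G ` A) s"
  proof (rule V[unfolded dedekind_complete_def, rule_format], intro conjI bexI[of _ "G u"])
    show "\<forall>a\<in>G ` A. leq V a (G u)" using A u by (auto simp: leq_iff subset_iff)
  qed (use A u in \<open>auto simp: G_closed\<close>)
  then show "\<exists>s. is_sup W A s" using is_sup_D[OF A(1)] by blast
qed

lemma laterally_complete_W:
  assumes V: "laterally_complete V"
  shows "laterally_complete W"
  unfolding laterally_complete_def
proof (intro allI impI, elim conjE)
  fix A assume A: "A \<subseteq> carrier W" "A \<noteq> {}" and pos: "\<forall>a\<in>A. leq W (zero W) a"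
    and disj: "\<forall>a\<in>A. \<forall>b\<in>A. a \<noteq> b \<longrightarrow> is_inf W {a, b} (zero W)"
  have "\<exists>s. is_sup V (G ` A) s"
  proof (rule V[unfolded laterally_complete_def, rule_format], intro conjI)
    show "\<forall>a\<in>G ` A. leq V (zero V) a"
      using pos A by (auto simp: leq_iff subset_iff zero_eq D_closed G_D V.zero_closed)
    show "\<forall>a\<in>G ` A. \<forall>b\<in>G ` A. a \<noteq> b \<longrightarrow> is_inf V {a, b} (zero V)"
    proof clarify
      fix a b assume ab: "a \<in> A" "b \<in> A" "G a \<noteq> G b"
      then have "is_inf V (G ` {a, b}) (G (zero W))" using disj A by (intro is_inf_G) auto
      then show "is_inf V {G a, G b} (zero V)" by (simp add: zero_eq G_D V.zero_closed)
    qed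
  qed (use A in \<open>auto simp: G_closed\<close>)
  then show "\<exists>s. is_sup W A s" using is_sup_D[OF A(1)] by blast
qed

end


section \<open>The bijection between H_nf(L) and C(B(L))\<close>

section \<open>Nearly finite Hausdorff continuous functions\<close>

lemma le_pcompl_SUP_iff: "b \<le> pcompl (\<Squnion>i\<in>I. F i) \<longleftrightarrow> (\<forall>i\<in>I. b \<le> pcompl (F i :: 'a::frame))"
  by (auto simp: le_pcompl_iff SUP_inf SUP_bot_conv)

lemma le_pcompl_sup_iff: "c \<le> pcompl (a \<squnion> b) \<longleftrightarrow> c \<le> pcompl a \<and> c \<le> pcompl (b :: 'a::frame)"
  by (simp add: le_pcompl_iff inf_sup_distrib2)

text \<open>Both sides have the same elements below them. This is what makes \<open>beta\<close>
  preserve joins.\<close>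

lemma pcompl_SUP_pcompl_pcompl:
  "pcompl (\<Squnion>i\<in>I. pcompl (pcompl (F i))) = pcompl (\<Squnion>i\<in>I. F i :: 'a::frame)"
proof -
  have "b \<le> pcompl (\<Squnion>i\<in>I. pcompl (pcompl (F i))) \<longleftrightarrow> b \<le> pcompl (\<Squnion>i\<in>I. F i)" for b
    by (simp add: le_pcompl_SUP_iff)
  then show ?thesis by (blast intro: order.antisym)
qed

lemma pcompl_top [simp]: "pcompl top = (bot :: 'a::frame)"
  using inf_pcompl[of "top :: 'a"] by simp

lemma pcompl_pcompl_Rep_booln [simp]: "pcompl (pcompl (Rep_booln x)) = Rep_booln x"
  using Rep_booln[of x] by simp

lemma beta_Rep_booln [simp]: "beta (Rep_booln x) = x"
  unfolding Rep_booln_inject[symmetric] by (simp add: beta.rep_eq)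

lemma frame_hom_beta: "frame_hom (beta :: 'a::frame \<Rightarrow> 'a booln)"
  unfolding frame_hom_def Rep_booln_inject[symmetric]
proof (intro conjI allI)
  show "Rep_booln (beta (top :: 'a)) = Rep_booln top" by (simp add: beta.rep_eq top_booln.rep_eq)
  show "Rep_booln (beta (a \<sqinter> b)) = Rep_booln (beta a \<sqinter> beta b)" for a b :: 'a
    by (simp add: beta.rep_eq inf_booln.rep_eq pcompl_pcompl_inf)
  show "Rep_booln (beta (\<Squnion>A)) = Rep_booln (\<Squnion>a\<in>A. beta a)" for A :: "'a set"
    using pcompl_SUP_pcompl_pcompl[of "\<lambda>a. a" A]
    by (simp add: beta.rep_eq Sup_booln.rep_eq image_image)
qed

lemma beta_mono: "a \<le> b \<Longrightarrow> beta a \<le> beta (b :: 'a::frame)"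
  by (simp add: less_eq_booln.rep_eq beta.rep_eq pcompl_mono2)

lemma beta_SUP: "beta (\<Squnion>i\<in>I. F i) = (\<Squnion>i\<in>I. beta (F i :: 'a::frame))"
  by (simp add: hom_Sup[OF frame_hom_beta] image_image)

lemma beta_inf: "beta (a \<sqinter> b) = beta a \<sqinter> beta (b :: 'a::frame)"
  and beta_top: "beta (top :: 'a::frame) = top"
  and beta_bot: "beta (bot :: 'a::frame) = bot"
  by (simp_all add: hom_inf hom_top hom_bot frame_hom_beta)

lemma beta_eq_top_iff: "beta (a :: 'a::frame) = top \<longleftrightarrow> pcompl (pcompl a) = top"
  unfolding Rep_booln_inject[symmetric] by (simp add: beta.rep_eq top_booln.rep_eq)

lemma hausdorffD:
  assumes "f \<in> Hnf_set"
  shows "frame_hom f"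
    "p < q \<Longrightarrow> pcompl (f (above_gen p)) \<le> f (below_gen q)"
    "p < q \<Longrightarrow> pcompl (f (below_gen q)) \<le> f (above_gen p)"
    "beta (\<Squnion>p. f (above_gen p)) = top" "beta (\<Squnion>q. f (below_gen q)) = top"
  using assms by (auto simp: Hnf_set_def hausdorff_continuous_def nearly_finite_def IC_set_def
      beta_eq_top_iff)

lemma frame_hom_Gamma:
  assumes "frame_hom f"
  shows "frame_hom (Gamma f)"
  unfolding frame_hom_def
  by (simp add: Gamma_def hom_top hom_inf hom_Sup frame_hom_beta assms image_image)

text \<open>For \<open>p < q\<close> the Hausdorff condition makes f(p,-) \<squnion> f(-,q) dense,
  and \<open>beta\<close> sends dense elements to 1: this is (r2). Near finiteness gives (r5) and
  (r6) in the same way.\<close>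

lemma Gamma_closed:
  assumes f: "f \<in> (Hnf_set :: (IR \<Rightarrow> 'a::frame) set)"
  shows "Gamma f \<in> C_set"
proof -
  note hom = hausdorffD(1)[OF f]
  have "frame_hom (Gamma f)" by (rule frame_hom_Gamma[OF hom])
  moreover have "beta (f (above_gen p)) \<squnion> beta (f (below_gen q)) = top" if "p < q" for p q
  proof -
    let ?x = "f (above_gen p)" and ?y = "f (below_gen q)"
    have "pcompl (?x \<squnion> ?y) \<le> pcompl ?x" "pcompl (?x \<squnion> ?y) \<le> pcompl ?y"
      by (simp_all add: pcompl_antimono)
    then have "pcompl (?x \<squnion> ?y) \<le> ?y \<sqinter> pcompl ?y"
      using order.trans[OF _ hausdorffD(2)[OF f that]] by simp
    then have "beta (?x \<squnion> ?y) = top" by (simp add: inf_pcompl bot_unique beta_eq_top_iff)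
    moreover have "beta (?x \<squnion> ?y) = beta ?x \<squnion> beta ?y"
      using beta_SUP[of "\<lambda>x. x" "{?x, ?y}"] by simp
    ultimately show ?thesis by simp
  qed
  ultimately show ?thesis
    using hausdorffD(4,5)[OF f] by (simp add: C_set_def IC_set_def Gamma_def beta_SUP)
qed

lemma Gamma_mono: "IC_le f g \<Longrightarrow> IC_le (Gamma f) (Gamma g)"
  by (simp add: IC_le_def Gamma_def beta_mono)

context
  fixes g :: "IR \<Rightarrow> 'a::frame booln"
  assumes g: "g \<in> C_set"
begin

text \<open>In general (r3) and (r4) for \<open>g\<close> hold only with the joins of the
  Booleanization; joining over \<open>r > p\<close> and \<open>s < q\<close> in L restores them
  there.\<close>

lemma gen_values_Delta:
  "gen_values (\<lambda>p. \<Squnion>r\<in>{p<..}. Rep_booln (g (above_gen r)))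
    (\<lambda>q. \<Squnion>s\<in>{..<q}. Rep_booln (g (below_gen s)))" (is "gen_values ?u ?d")
  unfolding gen_values_def
proof (intro conjI allI impI antimonoI monoI)
  show "?u p \<sqinter> ?d q = bot" if "q \<le> p" for p q
    unfolding bot_unique[symmetric]
  proof (rule SUP_inf_SUP_le)
    fix r s assume "r \<in> {p<..}" "s \<in> {..<q}"
    then have "g (above_gen r) \<sqinter> g (below_gen s) = bot"
      using that by (intro hom_r1 C_set_hom[OF g]) auto
    then show "Rep_booln (g (above_gen r)) \<sqinter> Rep_booln (g (below_gen s)) \<le> bot"
      by (metis inf_booln.rep_eq bot_booln.rep_eq order_refl)
  qed
  show "?u q \<le> ?u p" if "p \<le> q" for p q using that by (intro SUP_subset_mono) auto
  show "?d p \<le> ?d q" if "p \<le> q" for p q using that by (intro SUP_subset_mono) auto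
  show "?u p \<le> (\<Squnion>q\<in>{p<..}. ?u q)" for p
  proof (rule SUP_least)
    fix r assume "r \<in> {p<..}"
    then obtain q where "p < q" "q < r" using dense by auto
    then show "Rep_booln (g (above_gen r)) \<le> (\<Squnion>q\<in>{p<..}. ?u q)"
      by (intro SUP_upper2[of q] SUP_upper2[of r]) auto
  qed
  show "?d q \<le> (\<Squnion>p\<in>{..<q}. ?d p)" for q
  proof (rule SUP_least)
    fix s assume "s \<in> {..<q}"
    then obtain p where "s < p" "p < q" using dense by auto
    then show "Rep_booln (g (below_gen s)) \<le> (\<Squnion>p\<in>{..<q}. ?d p)"
      by (intro SUP_upper2[of p] SUP_upper2[of s]) auto
  qed
qed

lemma Delta_hom: "frame_hom (Delta g)"
  and Delta_above: "Delta g (above_gen p) = (\<Squnion>r\<in>{p<..}. Rep_booln (g (above_gen r)))"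
  and Delta_below: "Delta g (below_gen q) = (\<Squnion>s\<in>{..<q}. Rep_booln (g (below_gen s)))"
  unfolding Delta_def by (rule IR_ext[OF gen_values_Delta])+

text \<open>\<open>beta\<close> turns the joins of L into those of the Booleanization, where (r3)
  and (r4) for \<open>g\<close> remove the shift of the index.\<close>

lemma Gamma_Delta: "Gamma (Delta g) = g"
proof (rule hom_eqI)
  show "frame_hom (Gamma (Delta g))" by (rule frame_hom_Gamma[OF Delta_hom])
  show hom: "frame_hom g" by (rule C_set_hom[OF g])
  show "Gamma (Delta g) (above_gen p) = g (above_gen p)" for p
    by (simp add: Gamma_def Delta_above beta_SUP flip: hom_r3[OF hom])
  show "Gamma (Delta g) (below_gen q) = g (below_gen q)" for q
    by (simp add: Gamma_def Delta_below beta_SUP flip: hom_r4[OF hom])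
qed

lemma Delta_closed: "Delta g \<in> Hnf_set"
proof -
  have above: "g (above_gen p) = beta (Delta g (above_gen p))"
    and below: "g (below_gen p) = beta (Delta g (below_gen p))" for p
    using fun_cong[OF Gamma_Delta] by (simp_all add: Gamma_def)
  \<comment> \<open>In L, (r2) for \<open>g\<close> only says that the join of the two elements is
    dense; for regular elements this still puts the pseudocomplement of each below the
    other.\<close>
  have compl: "pcompl (Rep_booln (g (above_gen r))) \<sqinter> pcompl (Rep_booln (g (below_gen s))) = bot"
    if "r < s" for r s
  proof -
    let ?x = "Rep_booln (g (above_gen r))" and ?y = "Rep_booln (g (below_gen s))"
    have "pcompl (pcompl (?x \<squnion> ?y)) = top"
      using arg_cong[OF C_setD(1)[OF g that], of Rep_booln]
      by (simp add: sup_booln.rep_eq top_booln.rep_eq)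
    then have "pcompl (pcompl (pcompl (?x \<squnion> ?y))) = bot" by (simp only: pcompl_top)
    then have "pcompl (?x \<squnion> ?y) = bot" by simp
    moreover have "pcompl ?x \<sqinter> pcompl ?y \<le> pcompl (?x \<squnion> ?y)"
      by (simp add: le_pcompl_sup_iff)
    ultimately show ?thesis by (simp add: bot_unique)
  qed
  have "pcompl (Delta g (above_gen p)) \<le> Delta g (below_gen q) \<and>
      pcompl (Delta g (below_gen q)) \<le> Delta g (above_gen p)" if "p < q" for p q
  proof -
    \<comment> \<open>With \<open>p < r < s < q\<close> the elements \<open>?x\<close> and
      \<open>?y\<close> lie below the two values of \<open>Delta g\<close>, and \<open>compl\<close>
      applies to \<open>r < s\<close>.\<close>
    obtain r where r: "p < r" "r < q" using \<open>p < q\<close> dense by blast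
    obtain s where s: "r < s" "s < q" using r dense by blast
    let ?x = "Rep_booln (g (above_gen r))" and ?y = "Rep_booln (g (below_gen s))"
    have le: "?x \<le> Delta g (above_gen p)" "?y \<le> Delta g (below_gen q)"
      unfolding Delta_above Delta_below using r s by (auto intro: SUP_upper2)
    have "pcompl ?x \<le> pcompl (pcompl ?y)" "pcompl ?y \<le> pcompl (pcompl ?x)"
      unfolding le_pcompl_iff using compl[OF s(1)] by (simp_all add: inf_commute)
    then show ?thesis
      using le pcompl_antimono[OF le(1)] pcompl_antimono[OF le(2)] by (simp, meson order.trans)
  qed
  moreover have "beta (\<Squnion>p. Delta g (above_gen p)) = top" "beta (\<Squnion>p. Delta g (below_gen p)) = top"
    unfolding beta_SUP using C_setD(2,3)[OF g] by (simp_all flip: above below)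
  ultimately show ?thesis
    using Delta_hom by (simp add: Hnf_set_def hausdorff_continuous_def nearly_finite_def IC_set_def
        beta_eq_top_iff)
qed

end

lemma Delta_mono:
  "g \<in> C_set \<Longrightarrow> h \<in> C_set \<Longrightarrow> IC_le g h \<Longrightarrow> IC_le (Delta g) (Delta h)"
  by (auto simp: IC_le_def Delta_above Delta_below less_eq_booln.rep_eq intro!: SUP_mono')

text \<open>Hausdorff continuity bounds the regularisation: for \<open>p < r\<close> the double
  pseudocomplement of f(r,-) is below the pseudocomplement of f(-,r), hence below f(p,-). Together
  with (r3), and dually (r4), this recovers \<open>f\<close>.\<close>

lemma Delta_Gamma:
  assumes f: "f \<in> Hnf_set"
  shows "Delta (Gamma f) = f"
proof (rule hom_eqI)
  note hom = hausdorffD(1)[OF f]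
  note G = Gamma_closed[OF f]
  show "frame_hom (Delta (Gamma f))" by (rule Delta_hom[OF G])
  show "frame_hom f" by (rule hom)
  have "pcompl (pcompl (f (above_gen r))) \<le> f (above_gen p)" if "p < r" for p r
  proof -
    have "pcompl (pcompl (f (above_gen r))) \<le> pcompl (f (below_gen r))"
      by (intro pcompl_antimono) (simp add: le_pcompl_iff hom_r1[OF hom])
    also have "\<dots> \<le> f (above_gen p)" by (rule hausdorffD(3)[OF f that])
    finally show ?thesis .
  qed
  note le = this
  show "Delta (Gamma f) (above_gen p) = f (above_gen p)" for p
  proof (rule order.antisym)
    show "Delta (Gamma f) (above_gen p) \<le> f (above_gen p)"
      unfolding Delta_above[OF G] by (rule SUP_least) (simp add: Gamma_def beta.rep_eq le)
    show "f (above_gen p) \<le> Delta (Gamma f) (above_gen p)"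
      unfolding Delta_above[OF G] by (subst hom_r3[OF hom], rule SUP_mono')
        (simp add: Gamma_def beta.rep_eq le_pcompl_pcompl)
  qed
  have "pcompl (pcompl (f (below_gen s))) \<le> f (below_gen q)" if "s < q" for s q
  proof -
    have "pcompl (pcompl (f (below_gen s))) \<le> pcompl (f (above_gen s))"
      by (intro pcompl_antimono) (simp add: le_pcompl_iff inf_commute hom_r1[OF hom])
    also have "\<dots> \<le> f (below_gen q)" by (rule hausdorffD(2)[OF f that])
    finally show ?thesis .
  qed
  note le = this
  show "Delta (Gamma f) (below_gen q) = f (below_gen q)" for q
  proof (rule order.antisym)
    show "Delta (Gamma f) (below_gen q) \<le> f (below_gen q)"
      unfolding Delta_below[OF G] by (rule SUP_least) (simp add: Gamma_def beta.rep_eq le)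
    show "f (below_gen q) \<le> Delta (Gamma f) (below_gen q)"
      unfolding Delta_below[OF G] by (subst hom_r4[OF hom], rule SUP_mono')
        (simp add: Gamma_def beta.rep_eq le_pcompl_pcompl)
  qed
qed

lemma Hnf_space_simps [simp]:
  "carrier Hnf_space = Hnf_set" "leq Hnf_space = IC_le" "zero Hnf_space = Delta C_zero"
  "add Hnf_space f g = Delta (C_add (Gamma f) (Gamma g))"
  "scale Hnf_space c f = Delta (C_scale c (Gamma f))"
  by (simp_all add: Hnf_space_def)

lemma riesz_transport_Hnf:
  "riesz_transport C_space (Hnf_space :: (IR \<Rightarrow> 'a::frame) ordered_space) Gamma Delta"
proof (intro riesz_transport.intro riesz_space_C_space riesz_transport_axioms.intro)
  fix f g :: "IR \<Rightarrow> 'a" assume "f \<in> carrier Hnf_space" "g \<in> carrier Hnf_space"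
  then show "leq Hnf_space f g = leq C_space (Gamma f) (Gamma g)"
    using Delta_mono[of "Gamma f" "Gamma g"] Gamma_mono
    by (auto simp: Gamma_closed Delta_Gamma)
qed (simp_all add: Gamma_closed Delta_closed Delta_Gamma Gamma_Delta)

lemma universally_complete_Hnf:
  "universally_complete (Hnf_space :: (IR \<Rightarrow> 'a::frame) ordered_space)"
  unfolding universally_complete_def
  using riesz_transport.riesz_space_W[OF riesz_transport_Hnf]
    riesz_transport.dedekind_complete_W[OF riesz_transport_Hnf dedekind_complete_C_booln]
    riesz_transport.laterally_complete_W[OF riesz_transport_Hnf laterally_complete_C_booln]
  by blast


section \<open>C(L) as a Riesz subspace of H_nf(L)\<close>

section \<open>The embedding\<close>

text \<open>By (r2), whatever is disjoint from one of f(p,-) and f(-,q) lies below the other; (r5)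
  and (r6) are stronger than near finiteness.\<close>

lemma C_set_subset_Hnf_set: "(C_set :: (IR \<Rightarrow> 'a::frame) set) \<subseteq> Hnf_set"
proof
  fix f :: "IR \<Rightarrow> 'a" assume f: "f \<in> C_set"
  have "pcompl (f (above_gen p)) \<le> f (below_gen q)" "pcompl (f (below_gen q)) \<le> f (above_gen p)"
    if "p < q" for p q
    using C_setD(1)[OF f that]
      le_of_inf_sup_top[of "f (above_gen p)" "f (below_gen q)" "pcompl (f (above_gen p))"]
      le_of_inf_sup_top[of "f (below_gen q)" "f (above_gen p)" "pcompl (f (below_gen q))"]
    by (simp_all add: inf_commute[of "pcompl _"] inf_pcompl sup_commute)
  then show "f \<in> Hnf_set"
    using f C_setD(2,3)[OF f]
    by (simp add: Hnf_set_def hausdorff_continuous_def nearly_finite_def IC_set_def C_set_hom)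
qed

context
  fixes f :: "IR \<Rightarrow> 'a::frame"
  assumes f: "f \<in> C_set"
begin

lemma Gamma_closed_C: "Gamma f \<in> C_set"
  using f C_set_subset_Hnf_set Gamma_closed by blast

lemma Gamma_hom_C: "frame_hom (Gamma f)"
  by (rule C_set_hom[OF Gamma_closed_C])

text \<open>Reduces the compatibility of \<open>Gamma\<close> with an operation to generator values;
  these are built from finite meets and arbitrary joins, which \<open>beta\<close>
  preserves.\<close>

lemma Gamma_eqI:
  assumes "g \<in> C_set" "\<And>p. beta (f (above_gen p)) = g (above_gen p)"
    "\<And>p. beta (f (below_gen p)) = g (below_gen p)"
  shows "Gamma f = g"
  using assms by (intro hom_eqI Gamma_hom_C) (auto simp: Gamma_def C_set_hom)

end

lemma Gamma_zero: "Gamma C_zero = C_zero"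
  by (rule Gamma_eqI) (auto simp: C_zero_closed C_zero_above C_zero_below beta_top beta_bot)

lemma Gamma_minus: "f \<in> C_set \<Longrightarrow> Gamma (C_minus f) = C_minus (Gamma f)"
  by (rule Gamma_eqI)
    (simp_all add: C_minus_closed Gamma_closed_C C_minus_above C_minus_below Gamma_def[of f, THEN fun_cong])

lemma Gamma_add: "f \<in> C_set \<Longrightarrow> g \<in> C_set \<Longrightarrow> Gamma (C_add f g) = C_add (Gamma f) (Gamma g)"
  by (rule Gamma_eqI)
    (simp_all add: C_add_closed Gamma_closed_C C_add_above C_add_below beta_SUP beta_inf
      Gamma_def[THEN fun_cong])

lemma Gamma_scale_pos:
  "f \<in> C_set \<Longrightarrow> c > 0 \<Longrightarrow> Gamma (C_scale_pos c f) = C_scale_pos c (Gamma f)"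
  by (rule Gamma_eqI)
    (simp_all add: C_scale_pos_closed Gamma_closed_C C_scale_pos_above C_scale_pos_below
      setcompr_eq_image beta_SUP Gamma_def[of f, THEN fun_cong])

lemma Gamma_scale: "f \<in> C_set \<Longrightarrow> Gamma (C_scale c f) = C_scale c (Gamma f)"
  by (simp add: C_scale_def Gamma_scale_pos Gamma_zero Gamma_minus C_scale_pos_closed)

text \<open>Lets positivity in H_nf(L) be tested against the zero of C(L).\<close>

lemma Delta_zero: "Delta C_zero = C_zero"
  using Delta_Gamma[of C_zero] C_zero_closed C_set_subset_Hnf_set by (auto simp: Gamma_zero)

text \<open>The linear part holds because \<open>Gamma\<close> commutes with the operations and
  \<open>Delta\<close> inverts it. For the lattice part, a supremum in C(L) must be
  \<open>C_sup\<close>; its generator values are finite joins and meets, so it is the least upper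
  bound in H_nf(L) too, and dually for \<open>C_inf\<close>.\<close>

lemma riesz_embedding_C_Hnf:
  "riesz_embedding (C_space :: (IR \<Rightarrow> 'a::frame) ordered_space) Hnf_space (\<lambda>f. f)"
  unfolding riesz_embedding_def
proof (intro conjI ballI allI impI)
  fix f g s :: "IR \<Rightarrow> 'a" and c :: real
  assume "f \<in> carrier C_space"
  then have f: "f \<in> C_set" by simp
  show "scale C_space c f = scale Hnf_space c f"
    using Delta_Gamma[OF subsetD[OF C_set_subset_Hnf_set C_scale_closed[OF f]], of c]
    by (simp add: Gamma_scale f)
  assume "g \<in> carrier C_space"
  then have g: "g \<in> C_set" by simp
  show "add C_space f g = add Hnf_space f g"
    using Delta_Gamma[OF subsetD[OF C_set_subset_Hnf_set C_add_closed[OF f g]]]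
    by (simp add: Gamma_add f g)
  {
    assume s: "is_sup C_space {f, g} s"
    have "s = C_sup f g"
      using s is_sup_C_sup[OF f g] by (intro IC_le_antisym) (auto simp: is_sup_def C_set_hom)
    then show "is_sup Hnf_space {f, g} s"
      using f g C_set_subset_Hnf_set C_sup_closed[OF f g]
      by (auto simp: is_sup_def IC_le_def C_sup_above C_sup_below)
  next
    assume s: "is_inf C_space {f, g} s"
    have "s = C_inf f g"
      using s is_inf_C_inf[OF f g] by (intro IC_le_antisym) (auto simp: is_inf_def C_set_hom)
    then show "is_inf Hnf_space {f, g} s"
      using f g C_set_subset_Hnf_set C_inf_closed[OF f g]
      by (auto simp: is_inf_def IC_le_def C_inf_above C_inf_below)
  }
qed (use C_set_subset_Hnf_set in auto)


section \<open>Order density of C(L)\<close>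

section \<open>Density\<close>

text \<open>The analogue of \<open>IC_le_C_set_iff\<close>, with the Hausdorff condition on
  \<open>f\<close> in place of (r2): pseudocomplements reverse the given inequality.\<close>

lemma IC_le_Hnf_set_iff:
  assumes f: "f \<in> Hnf_set" and g: "g \<in> Hnf_set"
  shows "IC_le f g \<longleftrightarrow> (\<forall>p. f (above_gen p) \<le> g (above_gen p))"
proof -
  note hom = hausdorffD(1)[OF g]
  have "g (below_gen q) \<le> f (below_gen q)" if le: "\<forall>p. f (above_gen p) \<le> g (above_gen p)" for q
  proof (subst hom_r4[OF hom], rule SUP_least)
    fix s assume "s \<in> {..<q}"
    have "g (below_gen s) \<le> pcompl (g (above_gen s))" by (simp add: le_pcompl_iff hom_r1[OF hom])
    also have "\<dots> \<le> pcompl (f (above_gen s))" using le by (intro pcompl_antimono) auto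
    also have "\<dots> \<le> f (below_gen q)" using \<open>s \<in> {..<q}\<close> by (intro hausdorffD(2)[OF f]) auto
    finally show "g (below_gen s) \<le> f (below_gen q)" .
  qed
  then show ?thesis by (auto simp: IC_le_def)
qed

text \<open>Urysohn's construction; \<open>g\<close> is \<open>r\<close> on \<open>a\<close> and vanishes outside \<open>b\<close>.\<close>

lemma completely_below_function:
  fixes a b :: "'a::frame"
  assumes "completely_below a b" and r: "r > 0"
  obtains g where "g \<in> C_set" "\<forall>p<r. a \<le> g (above_gen p)" "\<forall>p<0. g (above_gen p) = top"
    "\<forall>p\<ge>0. g (above_gen p) \<le> b" "\<forall>p\<ge>r. g (above_gen p) = bot"
proof -
  obtain c :: "rat \<Rightarrow> 'a" where c: "a \<le> c 0" "c 1 \<le> b"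
    and rb: "\<And>s t. 0 \<le> s \<Longrightarrow> s < t \<Longrightarrow> t \<le> 1 \<Longrightarrow> rather_below (c s) (c t)"
    using assms(1) unfolding completely_below_def by blast
  \<comment> \<open>The chain \<open>c\<close> rises from \<open>a\<close> to \<open>b\<close>; the
    substitution \<open>1 - q / r\<close> reverses it and stretches it over [0,r], so that
    \<open>e r = c 0\<close> is above \<open>a\<close> and \<open>e 0 = c 1\<close> is below
    \<open>b\<close>.\<close>
  define e where "e q = (if q < 0 then top else if r < q then bot else c (1 - q / r))" for q
  have e_rb: "rather_below (e q) (e p)" if "p < q" for p q
  proof -
    consider "p < 0" | "r < q" | "0 \<le> p" "q \<le> r" by linarith
    then show ?thesis
    proof cases
      case 3
      then have "rather_below (c (1 - q / r)) (c (1 - p / r))"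
        using that r by (intro rb) (auto simp: field_simps)
      then show ?thesis using 3 that by (simp add: e_def)
    qed (use that r in \<open>auto simp: e_def rather_below_def\<close>)
  qed
  have top: "(\<Squnion>q. e q) = top"
    unfolding top_unique[symmetric] by (rule SUP_upper2[of "-1"]) (auto simp: e_def)
  have bot: "(\<Squnion>q. pcompl (e q)) = top"
    unfolding top_unique[symmetric] using r by (intro SUP_upper2[of "r + 1"]) (auto simp: e_def)
  note real = real_values_of_scale[OF e_rb top bot]
  define g where "g = IR_ext (\<lambda>p. \<Squnion>q\<in>{p<..}. e q) (\<lambda>q. \<Squnion>s\<in>{..<q}. pcompl (e s))"
  have above: "g (above_gen p) = (\<Squnion>q\<in>{p<..}. e q)" for p
    unfolding g_def by (rule IR_ext_above[OF real[THEN real_values_gen_values]])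
  have c1: "c s \<le> c 1" if "0 \<le> s" "s \<le> 1" for s
    using rb[of s 1] that by (cases "s = 1") (auto intro: rather_below_imp_le)
  show ?thesis
  proof
    show "g \<in> C_set" unfolding g_def by (rule IR_ext_in_C_set[OF real])
    show "\<forall>p<r. a \<le> g (above_gen p)"
      unfolding above using c r by (intro allI impI SUP_upper2[of r]) (auto simp: e_def)
    have "g (above_gen p) = top" if "p < 0" for p
    proof -
      obtain q where "p < q" "q < 0" using dense[OF \<open>p < 0\<close>] by blast
      then show ?thesis
        unfolding above top_unique[symmetric] by (intro SUP_upper2[of q]) (auto simp: e_def)
    qed
    then show "\<forall>p<0. g (above_gen p) = top" by blast
    have "e q \<le> b" if "0 < q" for q
    proof (cases "q \<le> r")
      case True
      then have "e q = c (1 - q / r)" using that by (simp add: e_def)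
      also have "\<dots> \<le> c 1" using True that r by (intro c1) (auto simp: field_simps)
      finally show ?thesis using c(2) by (rule order.trans)
    qed (use that in \<open>simp add: e_def\<close>)
    then show "\<forall>p\<ge>0. g (above_gen p) \<le> b"
      unfolding above by (auto intro!: SUP_least)
    show "\<forall>p\<ge>r. g (above_gen p) = bot"
      unfolding above bot_unique[symmetric] using r by (intro allI impI SUP_least) (auto simp: e_def)
  qed
qed

text \<open>Let \<open>t\<close> be another upper bound. For \<open>a\<close> completely below
  f(r,-), the Urysohn function \<open>g\<close> of height \<open>r\<close> satisfies 0 \<le> g \<le>
  f, so \<open>a\<close> \<le> g(p,-) \<le> t(p,-) for \<open>0 \<le> p < r\<close>. Complete
  regularity allows joining over \<open>a\<close>, and (r3) over \<open>r\<close>.\<close>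

lemma Hnf_is_sup_of_C:
  fixes f :: "IR \<Rightarrow> 'a::frame"
  assumes reg: "completely_regular TYPE('a)" and f: "f \<in> Hnf_set" and pos: "IC_le C_zero f"
  shows "is_sup Hnf_space {g \<in> C_set. IC_le C_zero g \<and> IC_le g f} f"
  unfolding is_sup_def Hnf_space_simps
proof (intro conjI ballI impI f)
  fix t assume t: "t \<in> Hnf_set"
    and ub: "\<forall>g\<in>{g \<in> C_set. IC_le C_zero g \<and> IC_le g f}. IC_le g t"
  have above: "f (above_gen r) \<le> t (above_gen p)" if "0 \<le> p" "p < r" for p r
  proof -
    have "a \<le> t (above_gen p)" if a: "completely_below a (f (above_gen r))" for a
    proof -
      have "r > 0" using \<open>0 \<le> p\<close> \<open>p < r\<close> by simp
      obtain g where g: "g \<in> C_set" "\<forall>p<r. a \<le> g (above_gen p)"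
        "\<forall>p<0. g (above_gen p) = top" "\<forall>p\<ge>0. g (above_gen p) \<le> f (above_gen r)"
        "\<forall>p\<ge>r. g (above_gen p) = bot"
        using completely_below_function[OF a \<open>r > 0\<close>] .
      have "C_zero (above_gen q) \<le> g (above_gen q)" for q
        by (simp add: C_zero_above g(3))
      then have "IC_le C_zero g" by (simp add: IC_le_C_set_iff C_zero_closed C_set_hom g(1))
      moreover have "g (above_gen q) \<le> f (above_gen q)" for q
      proof -
        \<comment> \<open>Below 0 the positivity of \<open>f\<close> decides, on [0,r) the bound
          g(q,-) \<le> f(r,-), and from \<open>r\<close> on g(q,-) is 0.\<close>
        consider "q < 0" | "0 \<le> q" "q < r" | "r \<le> q" by linarith
        then show ?thesis
        proof cases
          case 1
          then have "f (above_gen q) = top" using pos by (auto simp: IC_le_def C_zero_above top_unique dest: spec[of _ q])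
          then show ?thesis by simp
        next
          case 2
          then show ?thesis
            by (intro order.trans[OF g(4)[rule_format]] hom_above_antimono hausdorffD(1)[OF f]) auto
        qed (simp add: g(5))
      qed
      then have "IC_le g f" by (simp add: IC_le_C_set_iff hausdorffD(1)[OF f] g(1))
      ultimately have "g (above_gen p) \<le> t (above_gen p)" using ub g(1) by (simp add: IC_le_def)
      then show ?thesis using g(2) \<open>p < r\<close> by (blast intro: order.trans)
    qed
    then have "\<Squnion>{a. completely_below a (f (above_gen r))} \<le> t (above_gen p)" by (auto intro: Sup_least)
    then show ?thesis using reg unfolding completely_regular_def by metis
  qed
  have "f (above_gen p) \<le> t (above_gen p)" for p
  proof (cases "p < 0")
    case True
    \<comment> \<open>The zero function is itself one of the minorants of \<open>f\<close>, so
      \<open>t\<close> is positive.\<close>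
    have "IC_le C_zero t" using ub pos C_zero_closed IC_le_refl by blast
    then have "t (above_gen p) = top" using True by (auto simp: IC_le_def C_zero_above top_unique dest: spec[of _ p])
    then show ?thesis by simp
  next
    case False
    then show ?thesis
      by (subst hom_r3[OF hausdorffD(1)[OF f]]) (auto intro!: SUP_least above)
  qed
  then show "IC_le f t" by (simp add: IC_le_Hnf_set_iff[OF f t])
qed simp

theorem corollary4p8:
  assumes "completely_regular TYPE('a::frame)"
  shows "universal_completion (C_space :: (IR \<Rightarrow> 'a) ordered_space) Hnf_space (\<lambda>f. f)"
  unfolding universal_completion_def
proof (intro conjI ballI impI riesz_space_C_space universally_complete_Hnf riesz_embedding_C_Hnf)
  fix f :: "IR \<Rightarrow> 'a" assume "f \<in> carrier Hnf_space" "leq Hnf_space (zero Hnf_space) f"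
  then show "is_sup Hnf_space {g | g. g \<in> carrier C_space \<and> leq Hnf_space (zero Hnf_space) g \<and>
      leq Hnf_space g f} f"
    using Hnf_is_sup_of_C[OF assms, of f] by (simp add: Delta_zero)
qed

end
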